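(* A graph can be drawn as a local thrackle with straight-line segments as edges if and only if it is the disjoint union of caterpillars, spiked cycles of odd length, and spiked cycles of even length at least eight.
   Context: Graphs are finite and have no loops or multiple edges. A topological graph is a graph drawn in the plane such that its vertices are represented by points and its edges by non-self-intersecting arcs connecting the corresponding points. No edge passes through a point representing a vertex other than its endpoints. Tangencies between edges are not allowed: if two edges share an interior point, they properly cross at this point. A topological graph is simple if every pair of its edges intersect at most once: at a common endpoint or at a proper crossing. A path of length $3$ consists of $4$ distinct vertices and $3$ edges; it is plane if no two of its edges cross. A local thrackle is a simple topological graph with no plane path of length $3$. A caterpillar is a tree in which each vertex is adjacent to at most two non-leaf vertices. A spiked cycle is a connected graph with exactly one cycle such that every vertex not on this cycle has degree one. The length of a spiked cycle is the length of its unique cycle. The disjoint union may have any number of components of each of the listed kinds (possibly none of some kinds). *)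

theory Defs
  imports "HOL-Analysis.Analysis"
begin

section \<open>Finite simple graphs\<close>

definition simple_graph :: "'a set \<Rightarrow> 'a set set \<Rightarrow> bool" where
  "simple_graph V E \<longleftrightarrow> finite V \<and> (\<forall>e\<in>E. e \<subseteq> V \<and> card e = 2)"

definition connected_graph :: "'a set \<Rightarrow> 'a set set \<Rightarrow> bool" where
  "connected_graph V E \<longleftrightarrow> V \<noteq> {} \<and> (\<forall>u\<in>V. \<forall>v\<in>V. (u, v) \<in> {(a, b). {a, b} \<in> E}\<^sup>*)"

definition degree :: "'a set set \<Rightarrow> 'a \<Rightarrow> nat" where
  "degree E v = card {e \<in> E. v \<in> e}"

text \<open>A cycle is identified with its set of edges, so that rotations and reversals of the
  vertex sequence give the same cycle.\<close>

definition cycles :: "'a set set \<Rightarrow> 'a set set set" where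
  "cycles E = {C. C \<subseteq> E \<and> (\<exists>vs. distinct vs \<and> length vs \<ge> 3 \<and>
     C = {{vs ! i, vs ! (Suc i mod length vs)} | i. i < length vs})}"

definition tree :: "'a set \<Rightarrow> 'a set set \<Rightarrow> bool" where
  "tree V E \<longleftrightarrow> connected_graph V E \<and> cycles E = {}"

definition caterpillar :: "'a set \<Rightarrow> 'a set set \<Rightarrow> bool" where
  "caterpillar V E \<longleftrightarrow> tree V E \<and> (\<forall>v\<in>V. card {u \<in> V. {u, v} \<in> E \<and> degree E u \<noteq> 1} \<le> 2)"

definition spiked_cycle :: "'a set \<Rightarrow> 'a set set \<Rightarrow> nat \<Rightarrow> bool" where
  "spiked_cycle V E k \<longleftrightarrow> connected_graph V E \<and>
     (\<exists>C. cycles E = {C} \<and> card C = k \<and> (\<forall>v \<in> V - \<Union>C. degree E v = 1))"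

definition disjoint_union :: "('a set \<times> 'a set set) set \<Rightarrow> 'a set \<Rightarrow> 'a set set \<Rightarrow> bool" where
  "disjoint_union \<G> V E \<longleftrightarrow>
     (\<forall>(W, F)\<in>\<G>. simple_graph W F) \<and>
     (\<forall>H\<in>\<G>. \<forall>H'\<in>\<G>. H \<noteq> H' \<longrightarrow> fst H \<inter> fst H' = {}) \<and>
     V = (\<Union>(W, F)\<in>\<G>. W) \<and> E = (\<Union>(W, F)\<in>\<G>. F)"


section \<open>Drawings in the plane\<close>

text \<open>The plane is the type \<^typ>\<open>complex\<close>. A drawing consists of a map \<open>p\<close> placing the
  vertices and a map \<open>c\<close> sending each edge to the point set of the arc representing it.

  Two edges properly cross at \<open>x\<close> if \<open>x\<close> is an interior point of both and, up to a local
  homeomorphism of the plane, the two arcs look near \<open>x\<close> like the two coordinate axes near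
  the origin.\<close>

definition crosses_at ::
  "('a \<Rightarrow> complex) \<Rightarrow> ('a set \<Rightarrow> complex set) \<Rightarrow> 'a set \<Rightarrow> 'a set \<Rightarrow> complex \<Rightarrow> bool" where
  "crosses_at p c e f x \<longleftrightarrow> x \<notin> p ` (e \<union> f) \<and>
     (\<exists>U U' h k. open U \<and> open U' \<and> homeomorphism U U' h k \<and> x \<in> U \<and> h x = 0 \<and>
        h ` (c e \<inter> U) = {z \<in> U'. Im z = 0} \<and> h ` (c f \<inter> U) = {z \<in> U'. Re z = 0})"

definition topological_graph ::
  "'a set \<Rightarrow> 'a set set \<Rightarrow> ('a \<Rightarrow> complex) \<Rightarrow> ('a set \<Rightarrow> complex set) \<Rightarrow> bool" where
  "topological_graph V E p c \<longleftrightarrow>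
     simple_graph V E \<and> inj_on p V \<and>
     (\<forall>e\<in>E. \<exists>g. arc g \<and> {pathstart g, pathfinish g} = p ` e \<and> path_image g = c e) \<and>
     (\<forall>e\<in>E. \<forall>v\<in>V. p v \<in> c e \<longrightarrow> v \<in> e) \<and>
     (\<forall>e\<in>E. \<forall>f\<in>E. e \<noteq> f \<longrightarrow>
        (\<forall>x \<in> c e \<inter> c f. x \<notin> p ` (e \<union> f) \<longrightarrow> crosses_at p c e f x))"

definition simple_topological_graph ::
  "'a set \<Rightarrow> 'a set set \<Rightarrow> ('a \<Rightarrow> complex) \<Rightarrow> ('a set \<Rightarrow> complex set) \<Rightarrow> bool" where
  "simple_topological_graph V E p c \<longleftrightarrow> topological_graph V E p c \<and>
     (\<forall>e\<in>E. \<forall>f\<in>E. e \<noteq> f \<longrightarrow>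
        (\<forall>x \<in> c e \<inter> c f. \<forall>y \<in> c e \<inter> c f. x = y) \<and>
        (\<forall>x \<in> c e \<inter> c f. x \<in> p ` (e \<inter> f) \<or> crosses_at p c e f x))"

definition plane_path3 ::
  "'a set set \<Rightarrow> ('a \<Rightarrow> complex) \<Rightarrow> ('a set \<Rightarrow> complex set) \<Rightarrow> 'a list \<Rightarrow> bool" where
  "plane_path3 E p c vs \<longleftrightarrow> (\<exists>v0 v1 v2 v3. vs = [v0, v1, v2, v3] \<and> distinct vs \<and>
     {{v0, v1}, {v1, v2}, {v2, v3}} \<subseteq> E \<and>
     (\<forall>e \<in> {{v0, v1}, {v1, v2}, {v2, v3}}. \<forall>f \<in> {{v0, v1}, {v1, v2}, {v2, v3}}.
        e \<noteq> f \<longrightarrow> \<not> (\<exists>x. crosses_at p c e f x)))"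

definition local_thrackle ::
  "'a set \<Rightarrow> 'a set set \<Rightarrow> ('a \<Rightarrow> complex) \<Rightarrow> ('a set \<Rightarrow> complex set) \<Rightarrow> bool" where
  "local_thrackle V E p c \<longleftrightarrow> simple_topological_graph V E p c \<and> \<not> (\<exists>vs. plane_path3 E p c vs)"

definition straight_line ::
  "'a set set \<Rightarrow> ('a \<Rightarrow> complex) \<Rightarrow> ('a set \<Rightarrow> complex set) \<Rightarrow> bool" where
  "straight_line E p c \<longleftrightarrow> (\<forall>u v. {u, v} \<in> E \<longrightarrow> c {u, v} = closed_segment (p u) (p v))"

end

theory Submission
  imports Defs
begin

text \<open>When edges are straight, two edges with a common endpoint cannot cross, so a path of length
three is plane unless its first and last edge cross. Moving the vertices slightly into general
position keeps such crossings and removes every degeneracy. Hence a graph is drawable if and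
only if its vertices can be placed, possibly with coincidences, so that the first and the last
edge of every path of length three cross strictly (\<open>drawable_iff_paths_cross\<close>). This condition is
local to the components, so components may be placed independently, even on top of each other.

Necessity is a matter of orientation signs. If \<open>u, v, w, z\<close> is a path, then \<open>u\<close> and \<open>z\<close> lie on the
same side of the line \<open>vw\<close>. Three neighbours of \<open>v\<close> that are not leaves would lie pairwise on the
same side of the edges towards the respective third one, which contradicts the antisymmetry of
orientation; so every vertex has at most two neighbours that are not leaves
(\<open>at_most_two_inner_neighbours\<close>). A connected graph with this property is a caterpillar if it is
acyclic. Otherwise a cycle uses up all such neighbours of its vertices, so everything else
consists of leaves attached to it (\<open>off_cycle_leaf\<close>, \<open>cycle_unique\<close>). Around a cycle all turns have
the same direction. This fixes so many orientations that a cycle of length four is contradictory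
at once and one of length six violates a Grassmann-Pluecker relation
(\<open>no_square\<close>, \<open>no_hexagon\<close>).

For sufficiency it is enough to draw the cycle of length \<open>n\<close> with one leaf at each vertex, since
leaves at the same vertex may be drawn at the same point and a caterpillar is a subgraph of a
long enough spiked cycle (\<open>labelled_paths_cross\<close>). For \<open>n = 3\<close> the leaves are the reflections of the
vertices in the centroid. For \<open>n \<ge> 5\<close> suppose that the cycle is drawn as a closed zigzag, which
turns left at each vertex and whose edges at distance two cross. Then the leaf of a vertex can be
put just past the next vertex of the cycle (\<open>spiked_drawing_of_zigzags\<close>). Closed zigzags exist
for lengths 5, 7, 8, 9 and 11 by explicit coordinates, chosen so that the first five points also
form a closed zigzag by themselves; running once more around these five points lengthens the
cycle by five, which reaches every length except 6 from 5 on
(\<open>star_sequence_extend\<close>, \<open>star_sequence_exists\<close>).\<close>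

section \<open>Orientations and crossing segments\<close>

text \<open>Twice the signed area of the triangle \<open>abc\<close>: it is positive if and only if \<open>c\<close> lies strictly to the
left of the directed line from \<open>a\<close> to \<open>b\<close>.\<close>

definition orient :: "complex \<Rightarrow> complex \<Rightarrow> complex \<Rightarrow> real" where
  "orient a b c = (Re b - Re a) * (Im c - Im a) - (Im b - Im a) * (Re c - Re a)"

text \<open>Each of the segments \<open>ab\<close> and \<open>cd\<close> has its endpoints strictly on opposite sides of the line through
the other. Strict polynomial inequalities are used instead of a common point because they survive
small movements of the points.\<close>

definition strictly_cross :: "complex \<Rightarrow> complex \<Rightarrow> complex \<Rightarrow> complex \<Rightarrow> bool" where
  "strictly_cross a b c d \<longleftrightarrow>
     orient a b c * orient a b d < 0 \<and> orient c d a * orient c d b < 0"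

definition path3 :: "'a set set \<Rightarrow> 'a \<Rightarrow> 'a \<Rightarrow> 'a \<Rightarrow> 'a \<Rightarrow> bool" where
  "path3 E u v w z \<longleftrightarrow>
     distinct [u, v, w, z] \<and> {u, v} \<in> E \<and> {v, w} \<in> E \<and> {w, z} \<in> E"

text \<open>The map \<open>p\<close> is allowed to identify vertices; distinct points are only obtained by a later
perturbation. This freedom lets leaves of the same vertex, and different components, share
coordinates.\<close>

definition paths_cross :: "'a set set \<Rightarrow> ('a \<Rightarrow> complex) \<Rightarrow> bool" where
  "paths_cross E p \<longleftrightarrow>
     (\<forall>u v w z. path3 E u v w z \<longrightarrow> strictly_cross (p u) (p v) (p w) (p z))"

lemma orient_rotate: "orient b c a = orient a b c"
  by (simp add: orient_def algebra_simps)

lemma orient_swap: "orient b a c = - orient a b c"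
  by (simp add: orient_def algebra_simps)

lemma orient_degenerate [simp]: "orient a a b = 0" "orient a b a = 0" "orient a b b = 0"
  by (simp_all add: orient_def algebra_simps)

lemma strictly_cross_rev:
  "strictly_cross d c b a \<longleftrightarrow> strictly_cross a b c d"
proof -
  have "orient d c b = - orient c d b" "orient d c a = - orient c d a"
    "orient b a d = - orient a b d" "orient b a c = - orient a b c"
    by (rule orient_swap)+
  then show ?thesis
    by (auto simp: strictly_cross_def mult.commute)
qed

lemma path3_rev: "path3 E z w v u \<longleftrightarrow> path3 E u v w z"
  by (auto simp: path3_def insert_commute)

text \<open>If the lines \<open>ab\<close> and \<open>cd\<close> meet in \<open>x\<close>, then all four orientations that decide a crossing are multiples
of the cross product of the two directions, the factors being the positions of \<open>x\<close> on the
segments.\<close>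

lemma orient_of_common_point:
  assumes "x = a + s *\<^sub>R (b - a)" and "x = c + r *\<^sub>R (d - c)"
  shows "orient a b c = - r * orient 0 (b - a) (d - c)"
    and "orient a b d = (1 - r) * orient 0 (b - a) (d - c)"
    and "orient c d a = s * orient 0 (b - a) (d - c)"
    and "orient c d b = - (1 - s) * orient 0 (b - a) (d - c)"
proof -
  define u w where "u = b - a" and "w = d - c"
  have pa: "a = x - s *\<^sub>R u"
    unfolding assms(1) u_def by simp
  have pc: "c = x - r *\<^sub>R w"
    unfolding assms(2) w_def by simp
  note points = pa pc
  have "b = a + u" "d = c + w"
    by (simp_all add: u_def w_def)
  then have points': "b = x + (1 - s) *\<^sub>R u" "d = x + (1 - r) *\<^sub>R w"
    using points by (simp_all add: scaleR_left_diff_distrib)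
  have K: "orient 0 (b - a) (d - c) = Re u * Im w - Im u * Re w"
    by (simp add: orient_def u_def w_def)
  show "orient a b c = - r * orient 0 (b - a) (d - c)"
    unfolding K by (simp add: points points' orient_def algebra_simps)
  show "orient a b d = (1 - r) * orient 0 (b - a) (d - c)"
    unfolding K by (simp add: points points' orient_def algebra_simps)
  show "orient c d a = s * orient 0 (b - a) (d - c)"
    unfolding K by (simp add: points points' orient_def algebra_simps)
  show "orient c d b = - (1 - s) * orient 0 (b - a) (d - c)"
    unfolding K by (simp add: points points' orient_def algebra_simps)
qed

lemma in_closed_segment_iff:
  fixes x a b :: complex
  shows "x \<in> closed_segment a b \<longleftrightarrow> (\<exists>s. 0 \<le> s \<and> s \<le> 1 \<and> x = a + s *\<^sub>R (b - a))"
  by (simp add: in_segment algebra_simps)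

lemma segment_interior_parameter:
  fixes x a b :: complex
  assumes "x \<in> closed_segment a b" and "x \<noteq> a" and "x \<noteq> b"
  obtains s where "0 < s" and "s < 1" and "x = a + s *\<^sub>R (b - a)"
proof -
  obtain s where s: "0 \<le> s" "s \<le> 1" "x = a + s *\<^sub>R (b - a)"
    using assms(1) by (auto simp: in_closed_segment_iff)
  have "s \<noteq> 0" "s \<noteq> 1" using s(3) assms(2,3) by auto
  then have "0 < s" "s < 1" using s(1,2) by auto
  then show thesis using s(3) by (rule that)
qed

lemma strictly_cross_iff_common_point:
  assumes "x = a + s *\<^sub>R (b - a)" "0 < s" "s < 1"
    and "x = c + r *\<^sub>R (d - c)" "0 < r" "r < 1"
  shows "strictly_cross a b c d \<longleftrightarrow> orient 0 (b - a) (d - c) \<noteq> 0"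
proof -
  let ?K = "orient 0 (b - a) (d - c)"
  have "orient a b c * orient a b d = - (r * (1 - r)) * ?K\<^sup>2"
    "orient c d a * orient c d b = - (s * (1 - s)) * ?K\<^sup>2"
    unfolding orient_of_common_point[OF assms(1,4)] by (simp_all add: power2_eq_square algebra_simps)
  moreover have "0 < r * (1 - r)" "0 < s * (1 - s)"
    using assms by auto
  ultimately show ?thesis
    unfolding strictly_cross_def by (auto simp: mult_less_0_iff)
qed

text \<open>The parameters of the intersection point are given by Cramer's rule, and the sign conditions say
that they lie strictly between 0 and 1.\<close>

lemma strictly_cross_common_point:
  assumes "strictly_cross a b c d"
  obtains x s r where "x = a + s *\<^sub>R (b - a)" "0 < s" "s < 1"
    "x = c + r *\<^sub>R (d - c)" "0 < r" "r < 1" "orient 0 (b - a) (d - c) \<noteq> 0"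
proof -
  define K where "K = orient 0 (b - a) (d - c)"
  define s where "s = orient c d a / K"
  define r where "r = - orient a b c / K"
  have K1: "K = orient a b d - orient a b c"
    and K2: "K = orient c d a - orient c d b"
    by (simp_all add: K_def orient_def algebra_simps)
  have neg: "orient a b c * orient a b d < 0" "orient c d a * orient c d b < 0"
    using assms by (auto simp: strictly_cross_def)
  have K0: "K \<noteq> 0"
    using neg(1) K1 by (auto simp: mult_less_0_iff)
  have r: "0 < r" "r < 1"
    using neg(1) K0 unfolding r_def K1 by (auto simp: mult_less_0_iff field_simps)
  have s: "0 < s" "s < 1"
    using neg(2) K0 unfolding s_def K2 by (auto simp: mult_less_0_iff field_simps)
  have sr: "s * K = orient c d a" "r * K = - orient a b c"
    using K0 by (simp_all add: s_def r_def)
  have "K * Re a + (s * K) * (Re b - Re a) = K * Re c + (r * K) * (Re d - Re c)"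
    unfolding sr by (simp add: K_def orient_def algebra_simps)
  then have "K * Re (a + s *\<^sub>R (b - a)) = K * Re (c + r *\<^sub>R (d - c))"
    by (simp add: algebra_simps)
  moreover have "K * Im a + (s * K) * (Im b - Im a) = K * Im c + (r * K) * (Im d - Im c)"
    unfolding sr by (simp add: K_def orient_def algebra_simps)
  then have "K * Im (a + s *\<^sub>R (b - a)) = K * Im (c + r *\<^sub>R (d - c))"
    by (simp add: algebra_simps)
  ultimately have eq: "a + s *\<^sub>R (b - a) = c + r *\<^sub>R (d - c)"
    using K0 by (simp add: complex_eq_iff)
  show thesis
    by (rule that[OF refl s eq r K0[unfolded K_def]])
qed

lemma orient_affine:
  "orient a b (c + s *\<^sub>R (d - c)) = (1 - s) * orient a b c + s * orient a b d"
  by (simp add: orient_def algebra_simps)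

text \<open>Two distinct common points lie on both lines, so the lines coincide.\<close>

lemma collinear_if_two_common_points:
  assumes "x \<in> closed_segment a b" "y \<in> closed_segment a b"
    and "x \<in> closed_segment c d" "y \<in> closed_segment c d"
    and "x \<noteq> y"
  shows "orient a b c = 0"
proof -
  obtain s1 s2 where s: "x = a + s1 *\<^sub>R (b - a)" "y = a + s2 *\<^sub>R (b - a)"
    using assms by (auto simp: in_closed_segment_iff)
  obtain r1 r2 where r: "x = c + r1 *\<^sub>R (d - c)" "y = c + r2 *\<^sub>R (d - c)"
    using assms by (auto simp: in_closed_segment_iff)
  have "orient a b x = 0" "orient a b y = 0"
    unfolding s orient_affine by simp_all
  then have "(1 - r1) * orient a b c + r1 * orient a b d = 0"
    "(1 - r2) * orient a b c + r2 * orient a b d = 0"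
    unfolding r orient_affine by simp_all
  then have "(r1 - r2) * orient a b c = 0"
    by algebra
  moreover have "r1 \<noteq> r2"
    using r assms(5) by auto
  ultimately show ?thesis by simp
qed

text \<open>The local homeomorphism takes \<open>x\<close> to the origin, which lies on both coordinate axes; injectivity
brings the origin back to \<open>x\<close>.\<close>

lemma crosses_at_common:
  assumes "crosses_at p c e f x"
  shows "x \<in> c e" "x \<in> c f" "x \<notin> p ` (e \<union> f)"
proof -
  obtain U U' h k where U: "homeomorphism U U' h k" "x \<in> U" "h x = 0"
    "h ` (c e \<inter> U) = {z \<in> U'. Im z = 0}" "h ` (c f \<inter> U) = {z \<in> U'. Re z = 0}"
    using assms by (auto simp: crosses_at_def)
  have zero: "0 \<in> U'"
    using U(1-3) unfolding homeomorphism_def by (metis imageI)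
  have inj: "y = x" if "y \<in> U" "h y = 0" for y
    using that U(1-3) unfolding homeomorphism_def by metis
  have "0 \<in> h ` (c e \<inter> U)" "0 \<in> h ` (c f \<inter> U)"
    using zero U(4,5) by auto
  then show "x \<in> c e" "x \<in> c f"
    using inj by (metis Int_iff imageE)+
  show "x \<notin> p ` (e \<union> f)"
    using assms by (simp add: crosses_at_def)
qed

lemma parallel_directions:
  fixes u w :: complex
  assumes "orient 0 u w = 0" and "u \<noteq> 0"
  obtains l where "w = l *\<^sub>R u"
proof -
  have eq: "Re u * Im w = Im u * Re w"
    using assms(1) by (simp add: orient_def)
  show thesis
  proof (cases "Re u = 0")
    case True
    then have "Im u \<noteq> 0" "Re w = 0"
      using assms(2) eq by (auto simp: complex_eq_iff)
    then have "w = (Im w / Im u) *\<^sub>R u"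
      using True by (simp add: complex_eq_iff)
    then show thesis using that by blast
  next
    case False
    then have "w = (Re w / Re u) *\<^sub>R u"
      using eq by (simp add: complex_eq_iff field_simps)
    then show thesis using that by blast
  qed
qed

text \<open>This is what makes a crossing of two edges strict in a simple drawing: edges meeting in an
interior point of both and being parallel would overlap in a whole interval.\<close>

lemma parallel_segments_overlap:
  fixes a b c d :: complex
  assumes "x = a + s *\<^sub>R (b - a)" "0 < s" "s < 1"
    and "x = c + r *\<^sub>R (d - c)" "0 < r" "r < 1"
    and "c \<noteq> d" "a \<noteq> b" and par: "orient 0 (b - a) (d - c) = 0"
  obtains y where "y \<noteq> x" "y \<in> closed_segment a b" "y \<in> closed_segment c d"
proof -
  obtain l where l: "d - c = l *\<^sub>R (b - a)"
    using parallel_directions[OF par] \<open>a \<noteq> b\<close> by auto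
  have l0: "l \<noteq> 0" using l \<open>c \<noteq> d\<close> by auto
  \<comment> \<open>The largest shift along \<open>ab\<close> that stays on both segments; along \<open>cd\<close> it counts as \<open>t / l\<close>.\<close>
  define t where "t = min (min s (1 - s)) (\<bar>l\<bar> * min r (1 - r))"
  have t: "0 < t" "t \<le> s" "t \<le> 1 - s" "t \<le> \<bar>l\<bar> * min r (1 - r)"
    using assms(2-6) l0 by (auto simp: t_def)
  define y where "y = x + t *\<^sub>R (b - a)"
  have "y = a + (s + t) *\<^sub>R (b - a)"
    unfolding y_def assms(1) by (simp add: algebra_simps)
  then have 1: "y \<in> closed_segment a b"
    using t assms(2,3) unfolding in_closed_segment_iff by (intro exI[of _ "s + t"]) auto
  have "b - a = (1 / l) *\<^sub>R (d - c)"
    using l l0 by simp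
  then have "y = c + (r + t / l) *\<^sub>R (d - c)"
    unfolding y_def assms(4) by (simp add: scaleR_left.add)
  moreover have "\<bar>t / l\<bar> \<le> min r (1 - r)"
  proof -
    have "\<bar>t / l\<bar> = t / \<bar>l\<bar>" using t by (simp only: abs_divide)
    also have "\<dots> \<le> (\<bar>l\<bar> * min r (1 - r)) / \<bar>l\<bar>"
      using t(4) by (rule divide_right_mono) simp
    also have "\<dots> = min r (1 - r)"
      using l0 by simp
    finally show ?thesis .
  qed
  then have "0 \<le> r + t / l" "r + t / l \<le> 1"
    by linarith+
  ultimately have 2: "y \<in> closed_segment c d"
    unfolding in_closed_segment_iff by blast
  have "y \<noteq> x"
    using t \<open>a \<noteq> b\<close> by (simp add: y_def)
  then show thesis using that 1 2 by blast
qed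

section \<open>Straight-line local thrackles as crossing conditions on paths\<close>

text \<open>Edges sharing a vertex already meet there and so have no room for a crossing; hence the crossing
that a path of length three must contain is one between its first and its last edge.\<close>

lemma local_thrackle_paths_cross:
  assumes lt: "local_thrackle V E p c" and sl: "straight_line E p c"
  shows "paths_cross E p"
  unfolding paths_cross_def
proof (intro allI impI)
  fix u v w z
  assume P: "path3 E u v w z"
  let ?e = "{u, v}" and ?m = "{v, w}" and ?f = "{w, z}"
  have dist: "distinct [u, v, w, z]" and E: "?e \<in> E" "?m \<in> E" "?f \<in> E"
    using P by (auto simp: path3_def)
  have top: "topological_graph V E p c"
    and once: "\<And>e f x y. \<lbrakk>e \<in> E; f \<in> E; e \<noteq> f; x \<in> c e \<inter> c f; y \<in> c e \<inter> c f\<rbrakk> \<Longrightarrow> x = y"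
    and noplane: "\<not> plane_path3 E p c [u, v, w, z]"
    using lt unfolding local_thrackle_def simple_topological_graph_def by blast+
  have inj: "inj_on p V" and V: "{u, v, w, z} \<subseteq> V"
    using top E by (auto simp: topological_graph_def simple_graph_def)
  have c: "c ?e = closed_segment (p u) (p v)" "c ?m = closed_segment (p v) (p w)"
    "c ?f = closed_segment (p w) (p z)"
    using sl E by (auto simp: straight_line_def)
  have noadj: "\<not> crosses_at p c e f x"
    if "e \<in> E" "f \<in> E" "e \<noteq> f" "y \<in> e" "y \<in> f" "p y \<in> c e" "p y \<in> c f" for e f x y
  proof
    assume cr: "crosses_at p c e f x"
    have "x = p y"
      using once[OF that(1-3), of x "p y"] crosses_at_common[OF cr] that by blast
    then show False
      using crosses_at_common(3)[OF cr] that by blast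
  qed
  have neq: "?e \<noteq> ?m" "?m \<noteq> ?f" "?e \<noteq> ?f"
    using dist by (auto simp: doubleton_eq_iff)
  have end_pts: "p v \<in> c ?e" "p v \<in> c ?m" "p w \<in> c ?m" "p w \<in> c ?f"
    by (simp_all add: c)
  have adj: "\<not> crosses_at p c ?e ?m x" "\<not> crosses_at p c ?m ?e x"
    "\<not> crosses_at p c ?m ?f x" "\<not> crosses_at p c ?f ?m x" for x
    using noadj[of ?e ?m v] noadj[of ?m ?e v] noadj[of ?m ?f w] noadj[of ?f ?m w]
      E neq end_pts by auto
  obtain e f x where ef: "e \<in> {?e, ?m, ?f}" "f \<in> {?e, ?m, ?f}" "e \<noteq> f"
    "crosses_at p c e f x"
    using noplane dist E unfolding plane_path3_def by auto
  have "x \<in> c ?e \<inter> c ?f" "x \<notin> p ` (?e \<union> ?f)"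
  proof -
    have "(e = ?e \<and> f = ?f) \<or> (e = ?f \<and> f = ?e)"
      using ef adj by auto
    then show "x \<in> c ?e \<inter> c ?f" "x \<notin> p ` (?e \<union> ?f)"
      using crosses_at_common[OF ef(4)] by auto
  qed
  then have x: "x \<in> closed_segment (p u) (p v)" "x \<in> closed_segment (p w) (p z)"
    "x \<noteq> p u" "x \<noteq> p v" "x \<noteq> p w" "x \<noteq> p z"
    by (auto simp: c)
  obtain s where s: "0 < s" "s < 1" "x = p u + s *\<^sub>R (p v - p u)"
    using segment_interior_parameter[OF x(1,3,4)] .
  obtain r where r: "0 < r" "r < 1" "x = p w + r *\<^sub>R (p z - p w)"
    using segment_interior_parameter[OF x(2,5,6)] .
  have pneq: "p w \<noteq> p z" "p u \<noteq> p v"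
    using dist V inj by (auto dest: inj_onD)
  have "orient 0 (p v - p u) (p z - p w) \<noteq> 0"
  proof
    assume "orient 0 (p v - p u) (p z - p w) = 0"
    then obtain y where "y \<noteq> x" "y \<in> c ?e" "y \<in> c ?f"
      using parallel_segments_overlap[OF s(3,1,2) r(3,1,2) pneq] c by metis
    then show False
      using once[OF E(1,3) neq(3), of x y] x c by auto
  qed
  then show "strictly_cross (p u) (p v) (p w) (p z)"
    using strictly_cross_iff_common_point[OF s(3,1,2) r(3,1,2)] by simp
qed

text \<open>The affine coordinates with origin \<open>x\<close> and the directions of the two segments as basis vectors form a
homeomorphism as required for a proper crossing. In these coordinates a small square around the
origin meets the segments exactly in the axes.\<close>

lemma segments_cross_at:
  assumes ce: "c e = closed_segment a b" and cf: "c f = closed_segment a' b'"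
    and x1: "x = a + s *\<^sub>R (b - a)" "0 < s" "s < 1"
    and x2: "x = a' + r *\<^sub>R (b' - a')" "0 < r" "r < 1"
    and K: "orient 0 (b - a) (b' - a') \<noteq> 0"
    and x: "x \<notin> p ` (e \<union> f)"
  shows "crosses_at p c e f x"
proof -
  define u w where "u = b - a" and "w = b' - a'"
  define K where "K = orient 0 u w"
  define h where "h = (\<lambda>z. Complex (orient 0 (z - x) w / K) (- orient 0 (z - x) u / K))"
  define k where "k = (\<lambda>z. x + Re z *\<^sub>R u + Im z *\<^sub>R w)"
  define d where "d = min (min s (1 - s)) (min r (1 - r))"
  define U' where "U' = {z. \<bar>Re z\<bar> < d \<and> \<bar>Im z\<bar> < d}"
  define U where "U = h -` U'"
  have K0: "K \<noteq> 0"
    using K by (simp add: K_def u_def w_def)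
  have d: "0 < d" "d \<le> s" "d \<le> 1 - s" "d \<le> r" "d \<le> 1 - r"
    using x1 x2 by (auto simp: d_def)
  have hk: "h (k z) = z" for z
  proof -
    have "orient 0 (k z - x) w = Re z * K" "orient 0 (k z - x) u = - (Im z * K)"
      by (simp_all add: k_def K_def orient_def algebra_simps)
    then show ?thesis
      using K0 by (simp add: h_def complex_eq_iff)
  qed
  have kh: "k (h z) = z" for z
  proof -
    have "K * Re (k (h z)) = K * Re x + orient 0 (z - x) w * Re u - orient 0 (z - x) u * Re w"
      "K * Im (k (h z)) = K * Im x + orient 0 (z - x) w * Im u - orient 0 (z - x) u * Im w"
      using K0 by (simp_all add: h_def k_def field_simps)
    moreover have
      "K * Re x + orient 0 (z - x) w * Re u - orient 0 (z - x) u * Re w = K * Re z"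
      "K * Im x + orient 0 (z - x) w * Im u - orient 0 (z - x) u * Im w = K * Im z"
      by (simp_all add: K_def orient_def algebra_simps)
    ultimately show ?thesis
      using K0 by (simp add: complex_eq_iff)
  qed
  have conth: "continuous_on S h" for S
    unfolding h_def Complex_eq orient_def using K0 by (auto intro!: continuous_intros)
  have contk: "continuous_on S k" for S
    unfolding k_def by (intro continuous_intros)
  have "U' = {z. \<bar>Re z\<bar> < d} \<inter> {z. \<bar>Im z\<bar> < d}"
    by (auto simp: U'_def)
  then have openU': "open U'"
    by (auto intro!: open_Int open_Collect_less continuous_intros)
  then have openU: "open U"
    unfolding U_def by (rule open_vimage) (use conth in blast)
  have homeo: "homeomorphism U U' h k"
    unfolding homeomorphism_def using hk kh conth contk
    by (auto simp: U_def image_iff) (metis hk)+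
  have hx: "h x = 0"
    by (simp add: h_def orient_def complex_eq_iff)
  have xU: "x \<in> U"
    using hx d by (simp add: U_def U'_def)
  have on_e: "Im (h z) = 0" if z: "z \<in> closed_segment a b" for z
  proof -
    obtain t where "z = a + t *\<^sub>R (b - a)"
      using z by (auto simp: in_closed_segment_iff)
    then have diff: "z - x = (t - s) *\<^sub>R u"
      by (simp add: x1(1) u_def scaleR_left_diff_distrib)
    have "orient 0 (z - x) u = 0"
      unfolding diff by (simp add: orient_def)
    then show ?thesis
      by (simp add: h_def)
  qed
  have on_f: "Re (h z) = 0" if z: "z \<in> closed_segment a' b'" for z
  proof -
    obtain t where "z = a' + t *\<^sub>R (b' - a')"
      using z by (auto simp: in_closed_segment_iff)
    then have diff: "z - x = (t - r) *\<^sub>R w"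
      by (simp add: x2(1) w_def scaleR_left_diff_distrib)
    have "orient 0 (z - x) w = 0"
      unfolding diff by (simp add: orient_def)
    then show ?thesis
      by (simp add: h_def)
  qed
  have in_e: "k z \<in> closed_segment a b" if "z \<in> U'" "Im z = 0" for z
  proof -
    have "k z = a + (s + Re z) *\<^sub>R (b - a)"
      using that by (simp add: k_def x1(1) u_def scaleR_left.add)
    then show ?thesis
      using that d unfolding in_closed_segment_iff U'_def
      by (intro exI[of _ "s + Re z"]) auto
  qed
  have in_f: "k z \<in> closed_segment a' b'" if "z \<in> U'" "Re z = 0" for z
  proof -
    have "k z = a' + (r + Im z) *\<^sub>R (b' - a')"
      using that by (simp add: k_def x2(1) w_def scaleR_left.add)
    then show ?thesis
      using that d unfolding in_closed_segment_iff U'_def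
      by (intro exI[of _ "r + Im z"]) auto
  qed
  have he: "h ` (c e \<inter> U) = {z \<in> U'. Im z = 0}"
  proof
    show "h ` (c e \<inter> U) \<subseteq> {z \<in> U'. Im z = 0}"
      using on_e by (auto simp: ce U_def)
    show "{z \<in> U'. Im z = 0} \<subseteq> h ` (c e \<inter> U)"
    proof
      fix z assume "z \<in> {z \<in> U'. Im z = 0}"
      then have "k z \<in> c e \<inter> U" "z = h (k z)"
        using in_e hk by (auto simp: ce U_def)
      then show "z \<in> h ` (c e \<inter> U)" by blast
    qed
  qed
  have hf: "h ` (c f \<inter> U) = {z \<in> U'. Re z = 0}"
  proof
    show "h ` (c f \<inter> U) \<subseteq> {z \<in> U'. Re z = 0}"
      using on_f by (auto simp: cf U_def)
    show "{z \<in> U'. Re z = 0} \<subseteq> h ` (c f \<inter> U)"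
    proof
      fix z assume "z \<in> {z \<in> U'. Re z = 0}"
      then have "k z \<in> c f \<inter> U" "z = h (k z)"
        using in_f hk by (auto simp: cf U_def)
      then show "z \<in> h ` (c f \<inter> U)" by blast
    qed
  qed
  show ?thesis
    unfolding crosses_at_def using x openU openU' homeo xU hx he hf by blast
qed

definition general_position :: "'a set \<Rightarrow> ('a \<Rightarrow> complex) \<Rightarrow> bool" where
  "general_position V p \<longleftrightarrow> inj_on p V \<and>
     (\<forall>u\<in>V. \<forall>v\<in>V. \<forall>w\<in>V. distinct [u, v, w] \<longrightarrow> orient (p u) (p v) (p w) \<noteq> 0)"

text \<open>A nonzero polynomial has only finitely many roots, so none close to 0 except possibly 0 itself.
Orientations of linearly moving points are quadratic polynomials in time.\<close>

lemma eventually_quadratic_nonzero: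
  fixes A B C :: real
  assumes "A \<noteq> 0 \<or> B \<noteq> 0 \<or> C \<noteq> 0"
  shows "eventually (\<lambda>t. A + t * B + t\<^sup>2 * C \<noteq> 0) (at_right 0)"
proof -
  have near: "eventually (\<lambda>t::real. P + t * Q \<noteq> 0) (at_right 0)" if "P \<noteq> 0" for P Q
  proof -
    have "((\<lambda>t. P + t * Q) \<longlongrightarrow> P + 0 * Q) (at_right 0)"
      by (intro tendsto_intros)
    then show ?thesis
      using that by (intro tendsto_imp_eventually_ne) auto
  qed
  have pos: "eventually (\<lambda>t::real. t \<noteq> 0) (at_right 0)"
    by (simp add: eventually_at_filter)
  consider "A \<noteq> 0" | "A = 0" "B \<noteq> 0" | "A = 0" "B = 0" "C \<noteq> 0"
    using assms by blast
  then show ?thesis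
  proof cases
    case 1
    have "((\<lambda>t. A + t * B + t\<^sup>2 * C) \<longlongrightarrow> A + 0 * B + 0\<^sup>2 * C) (at_right 0)"
      by (intro tendsto_intros)
    then show ?thesis
      using 1 by (intro tendsto_imp_eventually_ne) auto
  next
    case 2
    show ?thesis
      using near[OF 2(2), of C] pos
    proof eventually_elim
      case (elim t)
      have "A + t * B + t\<^sup>2 * C = t * (B + t * C)"
        using 2(1) by (simp add: power2_eq_square algebra_simps)
      then show ?case using elim by simp
    qed
  next
    case 3
    show ?thesis
      using pos by eventually_elim (use 3 in simp)
  qed
qed

text \<open>The leading coefficient is the orientation of the directions of motion, so directions in general
position prevent the points from remaining collinear.\<close>

lemma orient_perturb:
  "orient (a + t *\<^sub>R a') (b + t *\<^sub>R b') (c + t *\<^sub>R c') =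
     orient a b c + t * (orient (a + a') (b + b') (c + c') - orient a b c - orient a' b' c')
       + t\<^sup>2 * orient a' b' c'"
  by (simp add: orient_def power2_eq_square algebra_simps)

lemma tendsto_orient [tendsto_intros]:
  assumes "(f \<longlongrightarrow> a) F" "(g \<longlongrightarrow> b) F" "(h \<longlongrightarrow> c) F"
  shows "((\<lambda>x. orient (f x) (g x) (h x)) \<longlongrightarrow> orient a b c) F"
  unfolding orient_def using assms by (intro tendsto_intros)

lemma eventually_strictly_cross:
  assumes "(f \<longlongrightarrow> a) F" "(g \<longlongrightarrow> b) F" "(h \<longlongrightarrow> c) F" "(k \<longlongrightarrow> d) F"
    and "strictly_cross a b c d"
  shows "eventually (\<lambda>x. strictly_cross (f x) (g x) (h x) (k x)) F"
  unfolding strictly_cross_def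
proof (rule eventually_conj)
  have "((\<lambda>x. orient (f x) (g x) (h x) * orient (f x) (g x) (k x))
     \<longlongrightarrow> orient a b c * orient a b d) F"
    using assms by (intro tendsto_intros)
  then show "eventually (\<lambda>x. orient (f x) (g x) (h x) * orient (f x) (g x) (k x) < 0) F"
    using assms(5) by (auto simp: strictly_cross_def intro: order_tendstoD)
  have "((\<lambda>x. orient (h x) (k x) (f x) * orient (h x) (k x) (g x))
     \<longlongrightarrow> orient c d a * orient c d b) F"
    using assms by (intro tendsto_intros)
  then show "eventually (\<lambda>x. orient (h x) (k x) (f x) * orient (h x) (k x) (g x) < 0) F"
    using assms(5) by (auto simp: strictly_cross_def intro: order_tendstoD)
qed

text \<open>A Vandermonde determinant: no three points of the parabola are collinear.\<close>

lemma orient_parabola: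
  "orient (Complex i (i\<^sup>2)) (Complex j (j\<^sup>2)) (Complex k (k\<^sup>2)) = (j - i) * (k - i) * (k - j)"
  by (simp add: orient_def power2_eq_square algebra_simps)

text \<open>Each vertex moves along a direction taken from the parabola. For small positive times there is
general position, as each coincidence or collinearity is a nontrivial polynomial equation in
the time, and the finitely many strict crossings persist by continuity.\<close>

lemma perturb_to_general_position:
  assumes V: "finite V" and E: "\<And>e. e \<in> E \<Longrightarrow> e \<subseteq> V" and cross: "paths_cross E p"
  obtains p' where "general_position V p'" and "paths_cross E p'"
proof -
  obtain idx :: "'a \<Rightarrow> nat" where idx: "inj_on idx V"
    using finite_imp_inj_to_nat_seg[OF V] by blast
  \<comment> \<open>Directions of motion, pairwise distinct in the first coordinate and no three collinear.\<close>
  define q where "q v = Complex (real (idx v)) ((real (idx v))\<^sup>2)" for v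
  define m where "m t v = p v + t *\<^sub>R q v" for t v
  have qinj: "Re (q u) \<noteq> Re (q v)" if "u \<in> V" "v \<in> V" "u \<noteq> v" for u v
    using that idx by (auto simp: q_def dest: inj_onD)
  have ev_inj: "eventually (\<lambda>t. \<forall>u\<in>V. \<forall>v\<in>V. u \<noteq> v \<longrightarrow> m t u \<noteq> m t v) (at_right 0)"
  proof (intro eventually_ball_finite[OF V] ballI)
    fix u v assume uv: "u \<in> V" "v \<in> V"
    show "eventually (\<lambda>t. u \<noteq> v \<longrightarrow> m t u \<noteq> m t v) (at_right 0)"
    proof (cases "u = v")
      case False
      have "eventually (\<lambda>t. (Re (p u) - Re (p v)) + t * (Re (q u) - Re (q v)) + t\<^sup>2 * 0 \<noteq> 0)
        (at_right 0)"
        using qinj[OF uv False] by (intro eventually_quadratic_nonzero) auto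
      then show ?thesis
        by eventually_elim (auto simp: m_def complex_eq_iff algebra_simps)
    qed simp
  qed
  have ev_col: "eventually (\<lambda>t. \<forall>u\<in>V. \<forall>v\<in>V. \<forall>w\<in>V. distinct [u, v, w] \<longrightarrow>
      orient (m t u) (m t v) (m t w) \<noteq> 0) (at_right 0)"
  proof (intro eventually_ball_finite[OF V] ballI)
    fix u v w assume uvw: "u \<in> V" "v \<in> V" "w \<in> V"
    show "eventually (\<lambda>t. distinct [u, v, w] \<longrightarrow> orient (m t u) (m t v) (m t w) \<noteq> 0)
        (at_right 0)"
    proof (cases "distinct [u, v, w]")
      case True
      then have "orient (q u) (q v) (q w) \<noteq> 0"
        using uvw idx unfolding q_def orient_parabola by (auto dest: inj_onD)
      then have "eventually (\<lambda>t. orient (m t u) (m t v) (m t w) \<noteq> 0) (at_right 0)"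
        unfolding m_def orient_perturb by (intro eventually_quadratic_nonzero) auto
      then show ?thesis
        by eventually_elim simp
    next
      case False
      then show ?thesis
        by (intro always_eventually) blast
    qed
  qed
  have ev_cross: "eventually (\<lambda>t. \<forall>a\<in>V. \<forall>b\<in>V. \<forall>c\<in>V. \<forall>d\<in>V. path3 E a b c d \<longrightarrow>
      strictly_cross (m t a) (m t b) (m t c) (m t d)) (at_right 0)"
  proof (intro eventually_ball_finite[OF V] ballI)
    fix a b c d
    have lim: "((\<lambda>t. m t v) \<longlongrightarrow> p v) (at_right 0)" for v
    proof -
      have "((\<lambda>t. p v + t *\<^sub>R q v) \<longlongrightarrow> p v + 0 *\<^sub>R q v) (at_right 0)"
        by (intro tendsto_intros)
      then show ?thesis by (simp add: m_def)
    qed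
    show "eventually (\<lambda>t. path3 E a b c d \<longrightarrow>
      strictly_cross (m t a) (m t b) (m t c) (m t d)) (at_right 0)"
    proof (cases "path3 E a b c d")
      case True
      then have "strictly_cross (p a) (p b) (p c) (p d)"
        using cross by (simp add: paths_cross_def)
      then have "eventually (\<lambda>t. strictly_cross (m t a) (m t b) (m t c) (m t d)) (at_right 0)"
        by (rule eventually_strictly_cross[OF lim lim lim lim])
      then show ?thesis
        by eventually_elim simp
    next
      case False
      then show ?thesis
        by (intro always_eventually) blast
    qed
  qed
  have "eventually (\<lambda>t. general_position V (m t) \<and> paths_cross E (m t)) (at_right 0)"
    using ev_inj ev_col ev_cross
  proof eventually_elim
    case (elim t)
    have "general_position V (m t)"
      using elim(1,2) unfolding general_position_def inj_on_def by blast
    moreover have "paths_cross E (m t)"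
      unfolding paths_cross_def
    proof (intro allI impI)
      fix a b c d
      assume P: "path3 E a b c d"
      then have "a \<in> V" "b \<in> V" "c \<in> V" "d \<in> V"
        using E by (auto simp: path3_def)
      then show "strictly_cross (m t a) (m t b) (m t c) (m t d)"
        using elim(3) P by simp
    qed
    ultimately show ?case ..
  qed
  then obtain t where "general_position V (m t)" "paths_cross E (m t)"
    using eventually_happens'[of "at_right (0::real)"] by force
  then show thesis using that by blast
qed

text \<open>In general position no vertex lies on a foreign edge and no two edges lie on a common line, so
any two edges meet at most once, and they cross properly wherever they meet outside vertices.\<close>

lemma general_position_local_thrackle:
  assumes G: "simple_graph V E" and gp: "general_position V p" and cross: "paths_cross E p"
  shows "\<exists>c. local_thrackle V E p c \<and> straight_line E p c"
proof -
  define c where "c e = convex hull (p ` e)" for e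
  have cseg: "c {u, v} = closed_segment (p u) (p v)" for u v
    by (simp add: c_def segment_convex_hull)
  have inj: "inj_on p V" and noncol: "\<And>u v w. \<lbrakk>{u, v, w} \<subseteq> V; distinct [u, v, w]\<rbrakk> \<Longrightarrow>
      orient (p u) (p v) (p w) \<noteq> 0"
    using gp unfolding general_position_def by auto
  have edge: "\<exists>u v. e = {u, v} \<and> u \<noteq> v \<and> u \<in> V \<and> v \<in> V" if "e \<in> E" for e
  proof -
    have "card e = 2" "e \<subseteq> V" using that G by (auto simp: simple_graph_def)
    then obtain u v where "e = {u, v}" "u \<noteq> v" by (auto simp: card_2_iff)
    then show ?thesis using \<open>e \<subseteq> V\<close> by auto
  qed
  have no_vertex: "w \<in> e" if "e \<in> E" "w \<in> V" and w: "p w \<in> c e" for e w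
  proof (rule ccontr)
    assume "w \<notin> e"
    obtain u v where uv: "e = {u, v}" "u \<noteq> v" "u \<in> V" "v \<in> V"
      using edge[OF \<open>e \<in> E\<close>] by blast
    obtain s where "p w = p u + s *\<^sub>R (p v - p u)"
      using w by (auto simp: uv cseg in_closed_segment_iff)
    then have "orient (p u) (p v) (p w) = 0"
      by (simp add: orient_affine)
    then show False
      using noncol[of u v w] uv \<open>w \<in> V\<close> \<open>w \<notin> e\<close> by auto
  qed
  have once: "x = y"
    if ef: "e \<in> E" "f \<in> E" "e \<noteq> f" and xy: "x \<in> c e \<inter> c f" "y \<in> c e \<inter> c f" for e f x y
  proof (rule ccontr)
    assume neq: "x \<noteq> y"
    obtain u v where uv: "e = {u, v}" "u \<noteq> v" "u \<in> V" "v \<in> V"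
      using edge[OF ef(1)] by blast
    have "f - e \<noteq> {}"
    proof
      assume "f - e = {}"
      then have "f \<subseteq> e" by blast
      moreover have "card e = 2" "card f = 2" "finite e"
        using ef G uv by (auto simp: simple_graph_def)
      ultimately show False
        using card_subset_eq ef(3) by metis
    qed
    then obtain w where "w \<in> f" "w \<notin> e" by blast
    then obtain w' where w: "f = {w, w'}" "w \<in> V" "w' \<in> V"
      using edge[OF ef(2)] by (auto simp: insert_commute)
    have "orient (p u) (p v) (p w) = 0"
      by (rule collinear_if_two_common_points[of x _ _ y _ "p w'"]) (use xy neq in \<open>auto simp: uv w cseg\<close>)
    then show False
      using noncol[of u v w] uv w \<open>w \<notin> e\<close> by auto
  qed
  have crossing: "crosses_at p c e f x"
    if ef: "e \<in> E" "f \<in> E" "e \<noteq> f" and x: "x \<in> c e \<inter> c f" "x \<notin> p ` (e \<union> f)" for e f x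
  proof -
    obtain u v where uv: "e = {u, v}" "u \<noteq> v" "u \<in> V" "v \<in> V"
      using edge[OF ef(1)] by blast
    obtain w z where wz: "f = {w, z}" "w \<noteq> z" "w \<in> V" "z \<in> V"
      using edge[OF ef(2)] by blast
    have xs: "x \<in> closed_segment (p u) (p v)" "x \<in> closed_segment (p w) (p z)"
      "x \<noteq> p u" "x \<noteq> p v" "x \<noteq> p w" "x \<noteq> p z"
      using x by (auto simp: uv wz cseg)
    obtain s where s: "0 < s" "s < 1" "x = p u + s *\<^sub>R (p v - p u)"
      using segment_interior_parameter[OF xs(1,3,4)] .
    obtain r where r: "0 < r" "r < 1" "x = p w + r *\<^sub>R (p z - p w)"
      using segment_interior_parameter[OF xs(2,5,6)] .
    have pneq: "p w \<noteq> p z" "p u \<noteq> p v"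
      using uv wz inj by (auto dest: inj_onD)
    have "orient 0 (p v - p u) (p z - p w) \<noteq> 0"
    proof
      assume "orient 0 (p v - p u) (p z - p w) = 0"
      then obtain y where "y \<noteq> x" "y \<in> c e" "y \<in> c f"
        using parallel_segments_overlap[OF s(3,1,2) r(3,1,2) pneq] uv wz cseg by metis
      then show False
        using once[OF ef, of x y] x by auto
    qed
    then show ?thesis
      using segments_cross_at[of c e "p u" "p v" f "p w" "p z", OF _ _ s(3,1,2) r(3,1,2) _ x(2)]
      by (simp add: uv wz cseg)
  qed
  have shared: "x \<in> p ` (e \<inter> f)"
    if ef: "e \<in> E" "f \<in> E" and x: "x \<in> c e \<inter> c f" "x \<in> p ` (e \<union> f)" for e f x
  proof -
    obtain v where v: "x = p v" "v \<in> e \<union> f" using x by blast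
    then have "v \<in> V" using ef G by (auto simp: simple_graph_def)
    then have "v \<in> e" "v \<in> f" using no_vertex ef x v by auto
    then show ?thesis using v by blast
  qed
  have arcs: "\<exists>g. arc g \<and> {pathstart g, pathfinish g} = p ` e \<and> path_image g = c e"
    if e: "e \<in> E" for e
  proof -
    obtain u v where uv: "e = {u, v}" "u \<noteq> v" "u \<in> V" "v \<in> V"
      using edge[OF e] by blast
    then have "p u \<noteq> p v" using inj by (auto dest: inj_onD)
    then show ?thesis
      by (intro exI[of _ "linepath (p u) (p v)"]) (auto simp: uv cseg arc_linepath)
  qed
  have "topological_graph V E p c"
    unfolding topological_graph_def using G inj arcs no_vertex crossing by blast
  then have "simple_topological_graph V E p c"
    unfolding simple_topological_graph_def using once crossing shared by blast
  moreover have "\<not> plane_path3 E p c vs" for vs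
  proof
    assume "plane_path3 E p c vs"
    then obtain u v w z where path: "vs = [u, v, w, z]" "distinct vs"
        "{{u, v}, {v, w}, {w, z}} \<subseteq> E"
      and pl: "\<forall>e\<in>{{u, v}, {v, w}, {w, z}}. \<forall>f\<in>{{u, v}, {v, w}, {w, z}}.
        e \<noteq> f \<longrightarrow> \<not> (\<exists>x. crosses_at p c e f x)"
      unfolding plane_path3_def by (elim exE conjE) (rule that)
    then have P: "path3 E u v w z"
      by (simp add: path3_def)
    have ne: "{u, v} \<noteq> {w, z}"
      using P by (auto simp: path3_def doubleton_eq_iff)
    have "strictly_cross (p u) (p v) (p w) (p z)"
      using P cross by (simp add: paths_cross_def)
    then obtain x s r where x: "x = p u + s *\<^sub>R (p v - p u)" "0 < s" "s < 1"
      "x = p w + r *\<^sub>R (p z - p w)" "0 < r" "r < 1"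
      by (rule strictly_cross_common_point)
    then have "x \<in> closed_segment (p u) (p v)" "x \<in> closed_segment (p w) (p z)"
      unfolding in_closed_segment_iff by (auto intro: less_imp_le)
    then have xin: "x \<in> c {u, v} \<inter> c {w, z}"
      by (simp add: cseg)
    have E: "{u, v} \<in> E" "{w, z} \<in> E" "distinct [u, v, w, z]"
      using P by (auto simp: path3_def)
    have "x \<notin> p ` ({u, v} \<union> {w, z})"
    proof
      assume "x \<in> p ` ({u, v} \<union> {w, z})"
      then have "x \<in> p ` ({u, v} \<inter> {w, z})"
        using shared[OF E(1,2) xin] by blast
      then show False using E(3) by auto
    qed
    then have "crosses_at p c {u, v} {w, z} x"
      using crossing[OF E(1,2) ne xin] by blast
    moreover have "\<not> (\<exists>x. crosses_at p c {u, v} {w, z} x)"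
      using pl[rule_format, of "{u, v}" "{w, z}"] ne by simp
    ultimately show False by blast
  qed
  ultimately have "local_thrackle V E p c"
    by (simp add: local_thrackle_def)
  moreover have "straight_line E p c"
    by (simp add: straight_line_def cseg)
  ultimately show ?thesis by blast
qed

lemma drawable_iff_paths_cross:
  assumes G: "simple_graph V E"
  shows "(\<exists>p c. local_thrackle V E p c \<and> straight_line E p c) \<longleftrightarrow> (\<exists>p. paths_cross E p)"
proof
  assume "\<exists>p c. local_thrackle V E p c \<and> straight_line E p c"
  then show "\<exists>p. paths_cross E p"
    using local_thrackle_paths_cross by blast
next
  assume "\<exists>p. paths_cross E p"
  then obtain p where "paths_cross E p" ..
  then obtain p' where "general_position V p'" "paths_cross E p'"
    using perturb_to_general_position[of V E p] G by (auto simp: simple_graph_def)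
  then show "\<exists>p c. local_thrackle V E p c \<and> straight_line E p c"
    using general_position_local_thrackle[OF G] by blast
qed

section \<open>Obstructions to a drawing\<close>

text \<open>The end vertices of a path of length three lie on the same side of its middle edge; this is the
form in which crossings enter the sign arguments below.\<close>

lemma strictly_cross_same_side:
  assumes "strictly_cross a b c d"
  shows "orient b c a * orient b c d > 0"
proof -
  have eq: "orient b c a - orient a b d = orient b c d - orient c d a"
    "orient b c a = orient a b c" "orient b c d = orient c d b"
    by (simp_all add: orient_def algebra_simps)
  have "orient b c a * orient a b d < 0" "orient b c d * orient c d a < 0"
    using assms eq by (auto simp: strictly_cross_def mult.commute)
  then show ?thesis
    using eq(1) by (auto simp: mult_less_0_iff zero_less_mult_iff)
qed

lemma paths_crossD:
  assumes "paths_cross F p" and "path3 F u v w z"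
  shows "orient (p u) (p v) (p w) * orient (p u) (p v) (p z) < 0"
    and "orient (p w) (p z) (p u) * orient (p w) (p z) (p v) < 0"
    and "orient (p v) (p w) (p u) * orient (p v) (p w) (p z) > 0"
  using assms strictly_cross_same_side unfolding paths_cross_def strictly_cross_def by blast+

text \<open>The path \<open>a, b, c, d\<close> puts \<open>c\<close> and \<open>d\<close> on opposite sides of the line \<open>ab\<close>, whereas \<open>ab\<close> is the middle edge of
the path \<open>d, a, b, c\<close>, which puts them on the same side.\<close>

lemma no_square:
  assumes "paths_cross F p" and "distinct [a, b, c, d]"
    and "{a, b} \<in> F" "{b, c} \<in> F" "{c, d} \<in> F" "{d, a} \<in> F"
  shows False
proof -
  have "path3 F a b c d" "path3 F d a b c"
    using assms(2-) by (auto simp: path3_def)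
  then have "orient (p a) (p b) (p c) * orient (p a) (p b) (p d) < 0"
    "orient (p a) (p b) (p d) * orient (p a) (p b) (p c) > 0"
    using paths_crossD(1,3)[OF assms(1)] by simp_all
  then show False
    by (simp add: mult.commute)
qed

text \<open>All turns of the hexagon have the same sign, and each path of length three determines two further
orientations. Among \<open>a, b, c, d, f\<close> they give the three products of the Grassmann-Pluecker relation
at \<open>a\<close> the same sign, although the products sum up to zero.\<close>

lemma no_hexagon:
  assumes cross: "paths_cross F p" and dist: "distinct [a, b, c, d, e, f]"
    and E: "{a, b} \<in> F" "{b, c} \<in> F" "{c, d} \<in> F" "{d, e} \<in> F" "{e, f} \<in> F" "{f, a} \<in> F"
  shows False
proof -
  let ?o = "\<lambda>x y z. orient (p x) (p y) (p z)"
  have P: "path3 F a b c d" "path3 F f a b c" "path3 F d e f a" "path3 F e f a b"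
    using dist E by (auto simp: path3_def)
  have turn: "?o b c d * ?o a b c > 0 \<and> ?o a b d * ?o a b c < 0 \<and> ?o a c d * ?o b c d < 0"
    if "path3 F a b c d" for a b c d
  proof -
    have "?o b c a = ?o a b c" "?o c d a = ?o a c d" "?o c d b = ?o b c d"
      by (simp_all add: orient_def algebra_simps)
    then show ?thesis
      using paths_crossD[OF cross that] by (simp add: mult.commute)
  qed
  note t = P[THEN turn]
  have gp: "?o a b c * ?o a d f - ?o a b d * ?o a c f + ?o a b f * ?o a c d = 0"
    by (simp add: orient_def algebra_simps)
  have rot: "?o d f a = ?o a d f" "?o f a c = ?o a c f" "?o f a b = ?o a b f"
    by (simp_all add: orient_def algebra_simps)
  have pos_pos: "x * z > 0" if "x * y > 0" "y * z > 0" for x y z :: real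
    using that by (auto simp: zero_less_mult_iff)
  have pos_neg: "x * z < 0" if "x * y > 0" "y * z < 0" for x y z :: real
    using that by (auto simp: zero_less_mult_iff mult_less_0_iff)
  have neg_neg: "x * z > 0" if "x * y < 0" "y * z < 0" for x y z :: real
    using that by (auto simp: zero_less_mult_iff mult_less_0_iff)
  have abc_fab: "?o a b c * ?o f a b > 0" and fab_efa: "?o f a b * ?o e f a > 0"
    and efa_dfa: "?o e f a * ?o d f a < 0" and abd_abc: "?o a b d * ?o a b c < 0"
    and fab_fac: "?o f a b * ?o f a c < 0" and abc_bcd: "?o a b c * ?o b c d > 0"
    and bcd_acd: "?o b c d * ?o a c d < 0"
    using t by (simp_all only: mult.commute)
  have "?o a b c * ?o d f a < 0"
    by (rule pos_neg[OF pos_pos[OF abc_fab fab_efa] efa_dfa])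
  moreover have "?o a b d * ?o f a c > 0"
    by (rule neg_neg[OF abd_abc pos_neg[OF abc_fab fab_fac]])
  moreover have "?o f a b * ?o a b c > 0"
    using abc_fab by (simp only: mult.commute)
  then have "?o f a b * ?o a c d < 0"
    by (rule pos_neg[OF _ pos_neg[OF abc_bcd bcd_acd]])
  ultimately have "?o a b c * ?o a d f < 0 \<and> ?o a b d * ?o a c f > 0 \<and> ?o a b f * ?o a c d < 0"
    unfolding rot by blast
  then show False
    using gp by linarith
qed

lemma other_neighbour:
  assumes G: "simple_graph V E" and uv: "{u, v} \<in> E" and deg: "degree E u \<noteq> 1"
  obtains w where "{u, w} \<in> E" "w \<noteq> u" "w \<noteq> v"
proof -
  have "{e \<in> E. u \<in> e} \<noteq> {{u, v}}"
  proof
    assume "{e \<in> E. u \<in> e} = {{u, v}}"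
    then show False using deg by (simp add: degree_def)
  qed
  then obtain e where e: "e \<in> E" "u \<in> e" "e \<noteq> {u, v}"
    using uv by blast
  have "card e = 2"
    using e G by (simp add: simple_graph_def)
  then obtain w where "e = {u, w}" "w \<noteq> u"
    using e(2) unfolding card_2_iff by (auto simp: insert_commute)
  then show thesis
    using that e by blast
qed

lemma edge_props:
  assumes "simple_graph V E" and "{u, v} \<in> E"
  shows "u \<in> V" "v \<in> V" "u \<noteq> v"
  using assms by (auto simp: simple_graph_def)

lemma degree_ne_1:
  assumes G: "simple_graph V E" and "{u, v} \<in> E" "{u, w} \<in> E" "v \<noteq> w"
  shows "degree E u \<noteq> 1"
proof
  assume "degree E u = 1"
  then obtain e where "{e \<in> E. u \<in> e} = {e}"
    unfolding degree_def by (auto simp: card_1_singleton_iff)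
  moreover have "{u, v} \<in> {e \<in> E. u \<in> e}" "{u, w} \<in> {e \<in> E. u \<in> e}"
    using assms(2,3) by simp_all
  ultimately have "{u, v} = {u, w}"
    by simp
  then show False
    using assms(4) by (auto simp: doubleton_eq_iff)
qed

text \<open>The set whose size is bounded in the definition of a caterpillar.\<close>

abbreviation inner_neighbours :: "'a set \<Rightarrow> 'a set set \<Rightarrow> 'a \<Rightarrow> 'a set" where
  "inner_neighbours V E v \<equiv> {u \<in> V. {u, v} \<in> E \<and> degree E u \<noteq> 1}"

text \<open>The path \<open>c, v, a, b\<close> makes the line \<open>cv\<close> separate \<open>a\<close> from \<open>b\<close>, but the paths starting with \<open>c', c, v\<close> put
both on the side of \<open>c'\<close>.\<close>

lemma no_triangle_with_tail:
  assumes cross: "paths_cross E p"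
    and dist: "distinct [v, a, b, c, c']"
    and E: "{v, a} \<in> E" "{v, b} \<in> E" "{a, b} \<in> E" "{v, c} \<in> E" "{c, c'} \<in> E"
  shows False
proof -
  let ?o = "\<lambda>x y z. orient (p x) (p y) (p z)"
  have "path3 E c v a b" "path3 E c' c v a" "path3 E c' c v b"
    using dist E by (auto simp: path3_def insert_commute)
  then have "?o c v a * ?o c v b < 0" "?o c v c' * ?o c v a > 0" "?o c v c' * ?o c v b > 0"
    using paths_crossD[OF cross] by blast+
  then show False
    by (auto simp: mult_less_0_iff zero_less_mult_iff)
qed

text \<open>Suppose \<open>a, b, c\<close> are three neighbours of \<open>v\<close> with further neighbours \<open>a', b', c'\<close>. The paths \<open>a', a, v, b\<close>
and \<open>a', a, v, c\<close> put \<open>b\<close> and \<open>c\<close> on the same side of the line \<open>av\<close>, and likewise for the lines \<open>bv\<close> and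
\<open>cv\<close>; the three statements are incompatible. They need \<open>a', b', c'\<close> to differ from \<open>a, b, c\<close>, that is,
no edges among \<open>a, b, c\<close>; such an edge would create a triangle with a tail or a square.\<close>

lemma at_most_two_inner_neighbours:
  assumes G: "simple_graph V E" and cross: "paths_cross E p"
  shows "card (inner_neighbours V E v) \<le> 2"
proof (rule ccontr)
  assume "\<not> ?thesis"
  then have "3 \<le> card (inner_neighbours V E v)"
    by simp
  then obtain T where T: "T \<subseteq> inner_neighbours V E v" "card T = 3"
    by (meson obtain_subset_with_card_n)
  then obtain a b c where abc: "T = {a, b, c}" "distinct [a, b, c]"
    unfolding card_3_iff by auto
  have E: "{v, a} \<in> E" "{v, b} \<in> E" "{v, c} \<in> E"
    and E': "{a, v} \<in> E" "{b, v} \<in> E" "{c, v} \<in> E"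
    and deg: "degree E a \<noteq> 1" "degree E b \<noteq> 1" "degree E c \<noteq> 1"
    using T abc by (auto simp: insert_commute)
  have v: "v \<noteq> a" "v \<noteq> b" "v \<noteq> c"
    using edge_props(3)[OF G] E by blast+
  let ?o = "\<lambda>x y z. orient (p x) (p y) (p z)"
  have no_chord: "{x, y} \<notin> E"
    if "distinct [v, x, y, z]" "{v, x} \<in> E" "{v, y} \<in> E" "{z, v} \<in> E" "degree E z \<noteq> 1" for x y z
  proof
    note h = that
    assume xy: "{x, y} \<in> E"
    obtain z' where z': "{z, z'} \<in> E" "z' \<noteq> z" "z' \<noteq> v"
      using other_neighbour[OF G h(4,5)] .
    have "z' \<noteq> x"
      using no_square[OF cross, of v y x z] xy that z' by (auto simp: insert_commute)
    moreover have "z' \<noteq> y"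
      using no_square[OF cross, of v x y z] xy that z' by (auto simp: insert_commute)
    ultimately show False
      using no_triangle_with_tail[OF cross, of v x y z z'] xy that z'
      by (auto simp: insert_commute)
  qed
  have same_side: "?o x v y * ?o x v z > 0"
    if "distinct [v, x, y, z]" "{v, x} \<in> E" "{x, v} \<in> E" "{v, y} \<in> E" "{v, z} \<in> E"
      "degree E x \<noteq> 1" "degree E y \<noteq> 1" "degree E z \<noteq> 1" for x y z
  proof -
    note h = that
    obtain x' where x': "{x, x'} \<in> E" "x' \<noteq> x" "x' \<noteq> v"
      using other_neighbour[OF G h(3,6)] .
    have "x' \<noteq> y"
      using no_chord[of x y z] that x' by (auto simp: insert_commute)
    moreover have "x' \<noteq> z"
      using no_chord[of x z y] that x' by (auto simp: insert_commute)
    ultimately have "path3 E x' x v y" "path3 E x' x v z"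
      using that x' by (auto simp: path3_def insert_commute)
    then have "?o x v x' * ?o x v y > 0" "?o x v x' * ?o x v z > 0"
      using paths_crossD(3)[OF cross] by blast+
    then show ?thesis
      by (auto simp: zero_less_mult_iff)
  qed
  have "?o a v b * ?o a v c > 0" "?o b v a * ?o b v c > 0" "?o c v a * ?o c v b > 0"
    using same_side[of a b c] same_side[of b a c] same_side[of c a b] abc v E E' deg by auto
  moreover have "?o b v a = - ?o a v b" "?o c v a = - ?o a v c" "?o c v b = - ?o b v c"
    by (simp_all add: orient_def algebra_simps)
  ultimately show False
    by (auto simp: zero_less_mult_iff mult_less_0_iff)
qed

section \<open>Cycles and components\<close>

definition cyc :: "'a list \<Rightarrow> 'a set set" where
  "cyc vs = {{vs ! i, vs ! (Suc i mod length vs)} | i. i < length vs}"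

lemma cycles_iff:
  "C \<in> cycles E \<longleftrightarrow> C \<subseteq> E \<and> (\<exists>vs. distinct vs \<and> 3 \<le> length vs \<and> C = cyc vs)"
  by (simp add: cycles_def cyc_def)

lemma Suc_mod_eq_iff:
  assumes "i < n" "j < n"
  shows "Suc i mod n = Suc j mod n \<longleftrightarrow> i = j"
  using assms by (auto simp: mod_Suc split: if_splits)

lemma Suc_mod_surj:
  assumes "j < n"
  obtains i where "i < n" "Suc i mod n = j"
proof (cases j)
  case 0
  then show thesis using that[of "n - 1"] assms by auto
next
  case (Suc i)
  then show thesis using that[of i] assms by auto
qed

lemma cyc_edge_iff:
  assumes "distinct vs" "i < length vs" "j < length vs"
  shows "{vs ! i, vs ! j} \<in> cyc vs \<longleftrightarrow> j = Suc i mod length vs \<or> i = Suc j mod length vs"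
proof -
  have lt: "Suc k mod length vs < length vs" for k
    using assms(2) by (intro mod_less_divisor) auto
  have "{vs ! i, vs ! j} = {vs ! k, vs ! (Suc k mod length vs)} \<longleftrightarrow>
    i = k \<and> j = Suc k mod length vs \<or> j = k \<and> i = Suc k mod length vs" if "k < length vs" for k
    using assms that lt by (auto simp: doubleton_eq_iff nth_eq_iff_index_eq)
  then show ?thesis
    unfolding cyc_def using assms by auto
qed

lemma Union_cyc: "\<Union>(cyc vs) = set vs"
proof -
  have "vs ! (Suc i mod length vs) \<in> set vs" if "i < length vs" for i
  proof (rule nth_mem)
    show "Suc i mod length vs < length vs"
      using that by (intro mod_less_divisor) auto
  qed
  then have "\<Union>(cyc vs) \<subseteq> set vs"
    by (auto simp: cyc_def)
  moreover have "x \<in> \<Union>(cyc vs)" if "x \<in> set vs" for x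
  proof -
    obtain i where "i < length vs" "x = vs ! i"
      using \<open>x \<in> set vs\<close> by (auto simp: in_set_conv_nth)
    then have "{x, vs ! (Suc i mod length vs)} \<in> cyc vs"
      by (auto simp: cyc_def)
    then show ?thesis by blast
  qed
  ultimately show ?thesis by blast
qed

text \<open>This count is all that the comparison of cycles below needs to know about the cyclic order.\<close>

lemma card_cyc_neighbours:
  assumes vs: "distinct vs" "3 \<le> length vs" and v: "v \<in> set vs"
  shows "card {u. {u, v} \<in> cyc vs} = 2"
proof -
  let ?n = "length vs"
  obtain j where j: "j < ?n" "v = vs ! j"
    using v by (auto simp: in_set_conv_nth)
  obtain i where i: "i < ?n" "Suc i mod ?n = j"
    using Suc_mod_surj[OF j(1)] .
  let ?k = "Suc j mod ?n"
  have k: "?k < ?n"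
    using j by (intro mod_less_divisor) auto
  have ne: "i \<noteq> ?k"
    using i j vs by (auto simp: mod_Suc split: if_splits)
  have "{u. {u, v} \<in> cyc vs} = {vs ! i, vs ! ?k}"
  proof (intro equalityI subsetI)
    fix u assume u: "u \<in> {u. {u, v} \<in> cyc vs}"
    then have "u \<in> set vs"
      using Union_cyc[of vs] by blast
    then obtain l where l: "l < ?n" "u = vs ! l"
      by (auto simp: in_set_conv_nth)
    then have "j = Suc l mod ?n \<or> l = Suc j mod ?n"
      using u j cyc_edge_iff[OF vs(1) l(1) j(1)] by simp
    then show "u \<in> {vs ! i, vs ! ?k}"
      using l i Suc_mod_eq_iff[OF l(1) i(1)] by auto
  next
    fix u assume "u \<in> {vs ! i, vs ! ?k}"
    then show "u \<in> {u. {u, v} \<in> cyc vs}"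
      using cyc_edge_iff[OF vs(1) i(1) j(1)] cyc_edge_iff[OF vs(1) k j(1)] i j by auto
  qed
  then show ?thesis
    using ne i k vs by (simp add: nth_eq_iff_index_eq)
qed

lemma card_cyc:
  assumes "distinct vs" "3 \<le> length vs"
  shows "card (cyc vs) = length vs"
proof -
  let ?n = "length vs"
  let ?f = "\<lambda>i. {vs ! i, vs ! (Suc i mod ?n)}"
  have lt: "Suc i mod ?n < ?n" for i
    using assms by (intro mod_less_divisor) auto
  have "inj_on ?f {..<?n}"
  proof (rule inj_onI)
    fix i j assume ij: "i \<in> {..<?n}" "j \<in> {..<?n}" "?f i = ?f j"
    then have "i = j \<or> i = Suc j mod ?n \<and> Suc i mod ?n = j"
      using assms lt by (auto simp: doubleton_eq_iff nth_eq_iff_index_eq)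
    then show "i = j"
      using ij assms by (auto simp: mod_Suc split: if_splits)
  qed
  moreover have "cyc vs = ?f ` {..<?n}"
    by (auto simp: cyc_def)
  ultimately show ?thesis
    by (simp add: card_image)
qed

text \<open>The form in which connectedness is used: to describe all vertices, it suffices to exhibit a
nonempty set of vertices closed under adjacency.\<close>

lemma connected_closed_eq:
  assumes conn: "connected_graph V E" and S: "S \<subseteq> V" "S \<noteq> {}"
    and closed: "\<And>u v. \<lbrakk>u \<in> S; {u, v} \<in> E\<rbrakk> \<Longrightarrow> v \<in> S"
  shows "S = V"
proof
  show "V \<subseteq> S"
  proof
    fix v assume v: "v \<in> V"
    obtain u where u: "u \<in> S" using S(2) by blast
    have "(u, v) \<in> {(a, b). {a, b} \<in> E}\<^sup>*"
      using conn u v S(1) unfolding connected_graph_def by blast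
    then show "v \<in> S"
      by (induction rule: rtrancl_induct) (use u closed in auto)
  qed
qed (rule S(1))

text \<open>The two neighbours on the cycle are not leaves, and there is no room for a third such
neighbour.\<close>

lemma cycle_neighbours:
  assumes G: "simple_graph V E" and two: "\<And>v. card (inner_neighbours V E v) \<le> 2"
    and C: "C \<in> cycles E" and v: "v \<in> \<Union>C"
  shows "{u. {u, v} \<in> C} = inner_neighbours V E v" and "degree E v \<noteq> 1"
proof -
  obtain vs where vs: "distinct vs" "3 \<le> length vs" "C = cyc vs" "C \<subseteq> E"
    using C by (auto simp: cycles_iff)
  have deg: "degree E u \<noteq> 1" if "u \<in> \<Union>C" for u
  proof -
    have "card {w. {w, u} \<in> C} = 2"
      using card_cyc_neighbours vs that Union_cyc by metis
    then obtain x y where "{x, u} \<in> C" "{y, u} \<in> C" "x \<noteq> y"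
      unfolding card_2_iff by blast
    then show ?thesis
      using degree_ne_1[OF G, of u x y] vs(4) by (auto simp: insert_commute)
  qed
  then show "degree E v \<noteq> 1" using v .
  have "finite (inner_neighbours V E v)"
    using G by (simp add: simple_graph_def)
  moreover have "{u. {u, v} \<in> C} \<subseteq> inner_neighbours V E v"
    using deg vs(4) edge_props[OF G] by blast
  moreover have "card {u. {u, v} \<in> C} = 2"
    using card_cyc_neighbours vs v Union_cyc by metis
  ultimately show "{u. {u, v} \<in> C} = inner_neighbours V E v"
    using two[of v] by (intro card_seteq) auto
qed

text \<open>The vertices of the cycle and the leaves attached to them form a set closed under adjacency.\<close>

lemma off_cycle_leaf:
  assumes G: "simple_graph V E" and two: "\<And>v. card (inner_neighbours V E v) \<le> 2"
    and conn: "connected_graph V E" and C: "C \<in> cycles E" and v: "v \<in> V" "v \<notin> \<Union>C"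
  shows "degree E v = 1"
proof -
  define S where "S = \<Union>C \<union> {v \<in> V. degree E v = 1 \<and> (\<exists>c\<in>\<Union>C. {v, c} \<in> E)}"
  obtain vs where vs: "distinct vs" "3 \<le> length vs" "C = cyc vs" "C \<subseteq> E"
    using C by (auto simp: cycles_iff)
  have "\<Union>C \<noteq> {}"
    using vs Union_cyc[of vs] by auto
  have "S = V"
  proof (rule connected_closed_eq[OF conn])
    have "\<Union>C \<subseteq> V"
      using vs(4) G by (auto simp: simple_graph_def)
    then show "S \<subseteq> V" by (auto simp: S_def)
    show "S \<noteq> {}" using \<open>\<Union>C \<noteq> {}\<close> by (auto simp: S_def)
  next
    fix u w assume u: "u \<in> S" and uw: "{u, w} \<in> E"
    have V: "u \<in> V" "w \<in> V" using edge_props[OF G uw] by auto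
    show "w \<in> S"
    proof (cases "u \<in> \<Union>C")
      case True
      show ?thesis
      proof (cases "degree E w = 1")
        case False
        then have "w \<in> inner_neighbours V E u"
          using V uw by (simp add: insert_commute)
        then have "{w, u} \<in> C"
          using cycle_neighbours(1)[OF G two C True] by blast
        then show ?thesis by (auto simp: S_def)
      qed (use True V uw in \<open>auto simp: S_def insert_commute\<close>)
    next
      case False
      then obtain c where c: "degree E u = 1" "c \<in> \<Union>C" "{u, c} \<in> E"
        using u by (auto simp: S_def)
      then have "w = c"
        using degree_ne_1[OF G uw] by blast
      then show ?thesis using c by (auto simp: S_def)
    qed
  qed
  then show ?thesis
    using v by (auto simp: S_def)
qed

text \<open>Vertices of \<open>C'\<close> are not leaves, hence lie on \<open>C\<close>, and there both cycles use the same two edges. By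
symmetry any two cycles coincide.\<close>

lemma cycle_unique:
  assumes G: "simple_graph V E" and two: "\<And>v. card (inner_neighbours V E v) \<le> 2"
    and conn: "connected_graph V E" and C: "C \<in> cycles E" and C': "C' \<in> cycles E"
  shows "C' \<subseteq> C"
proof
  fix e assume e: "e \<in> C'"
  have "e \<in> E" using e C' by (auto simp: cycles_iff)
  then have "card e = 2" using G by (simp add: simple_graph_def)
  then obtain a b where ab: "e = {a, b}" by (auto simp: card_2_iff)
  have b: "b \<in> \<Union>C'" "b \<in> V"
    using e ab \<open>e \<in> E\<close> G by (auto simp: simple_graph_def)
  have "b \<in> \<Union>C"
    using off_cycle_leaf[OF G two conn C b(2)] cycle_neighbours(2)[OF G two C' b(1)] by blast
  then have "{u. {u, b} \<in> C} = {u. {u, b} \<in> C'}"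
    using cycle_neighbours(1)[OF G two C] cycle_neighbours(1)[OF G two C' b(1)] by (simp only:)
  then show "e \<in> C" using e ab by blast
qed

lemma paths_cross_component:
  assumes G: "simple_graph V E" and conn: "connected_graph V E" and cross: "paths_cross E p"
  shows "caterpillar V E \<or> (\<exists>k. odd k \<and> spiked_cycle V E k) \<or>
    (\<exists>k. even k \<and> 8 \<le> k \<and> spiked_cycle V E k)"
proof (cases "cycles E = {}")
  case True
  then have "caterpillar V E"
    unfolding caterpillar_def tree_def
    using conn at_most_two_inner_neighbours[OF G cross] by blast
  then show ?thesis ..
next
  case False
  then obtain C where C: "C \<in> cycles E" by blast
  note two = at_most_two_inner_neighbours[OF G cross]
  have "cycles E = {C}"
    using cycle_unique[OF G two conn] C by blast
  moreover have "\<forall>v\<in>V - \<Union>C. degree E v = 1"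
    using off_cycle_leaf[OF G two conn C] by blast
  ultimately have spiked: "spiked_cycle V E (card C)"
    using conn by (auto simp: spiked_cycle_def)
  obtain vs where vs: "distinct vs" "3 \<le> length vs" "C = cyc vs" "C \<subseteq> E"
    using C by (auto simp: cycles_iff)
  have n: "card C = length vs"
    using card_cyc vs by simp
  have edge: "{vs ! i, vs ! j} \<in> E" if "i < length vs" "j = (i + 1) mod length vs" for i j
    using that vs(3,4) by (auto simp: cyc_def)
  have "length vs \<noteq> 4"
  proof
    assume l: "length vs = 4"
    then have dist: "distinct [vs ! 0, vs ! 1, vs ! 2, vs ! 3]"
      using vs(1) by (simp add: nth_eq_iff_index_eq)
    have E: "{vs ! 0, vs ! 1} \<in> E" "{vs ! 1, vs ! 2} \<in> E" "{vs ! 2, vs ! 3} \<in> E" "{vs ! 3, vs ! 0} \<in> E"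
      using l by (auto intro!: edge)
    show False
      by (rule no_square[OF cross dist E])
  qed
  moreover have "length vs \<noteq> 6"
  proof
    assume l: "length vs = 6"
    then have dist: "distinct [vs ! 0, vs ! 1, vs ! 2, vs ! 3, vs ! 4, vs ! 5]"
      using vs(1) by (simp add: nth_eq_iff_index_eq)
    have E: "{vs ! 0, vs ! 1} \<in> E" "{vs ! 1, vs ! 2} \<in> E" "{vs ! 2, vs ! 3} \<in> E" "{vs ! 3, vs ! 4} \<in> E" "{vs ! 4, vs ! 5} \<in> E" "{vs ! 5, vs ! 0} \<in> E"
      using l by (auto intro!: edge)
    show False
      by (rule no_hexagon[OF cross dist E])
  qed
  ultimately have "odd (card C) \<or> 8 \<le> card C"
    using vs(2) n by (cases "even (card C)") (auto elim!: evenE)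
  then show ?thesis
    using spiked by blast
qed

lemma paths_cross_subset:
  assumes "paths_cross E p" "F \<subseteq> E"
  shows "paths_cross F p"
  using assms unfolding paths_cross_def path3_def by blast

lemma components_exist:
  assumes G: "simple_graph V E"
  obtains \<G> where "disjoint_union \<G> V E"
    and "\<forall>(W, F)\<in>\<G>. simple_graph W F \<and> connected_graph W F"
proof -
  define R where "R = {(a, b). {a, b} \<in> E}"
  define comp where "comp v = {u. (v, u) \<in> R\<^sup>*}" for v
  define sub where "sub W = {e \<in> E. e \<subseteq> W}" for W
  define \<G> where "\<G> = (\<lambda>v. (comp v, sub (comp v))) ` V"
  have "sym R" by (auto simp: R_def sym_def insert_commute)
  then have symR: "sym (R\<^sup>*)" by (rule sym_rtrancl)
  have self: "v \<in> comp v" for v by (simp add: comp_def)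
  have comp_eq: "comp u = comp v" if "u \<in> comp v" for u v
    using that symR unfolding comp_def by (auto dest: symD intro: rtrancl_trans)
  have compV: "comp v \<subseteq> V" if "v \<in> V" for v
  proof
    fix u assume "u \<in> comp v"
    then have "(v, u) \<in> R\<^sup>*" by (simp add: comp_def)
    then show "u \<in> V"
      by (induction rule: rtrancl_induct) (use that edge_props[OF G] in \<open>auto simp: R_def\<close>)
  qed
  have edge_comp: "e \<in> sub (comp v)" if e: "e \<in> E" and v: "v \<in> e" for e v
  proof -
    have "card e = 2" using e G by (simp add: simple_graph_def)
    then obtain u where "e = {v, u}"
      using v unfolding card_2_iff by (auto simp: insert_commute)
    then show ?thesis
      using e by (auto simp: sub_def comp_def R_def)
  qed
  have simple: "simple_graph (comp v) (sub (comp v))" if "v \<in> V" for v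
    using G compV[OF that] finite_subset unfolding simple_graph_def sub_def by blast
  have conn: "connected_graph (comp v) (sub (comp v))" if "v \<in> V" for v
    unfolding connected_graph_def
  proof (intro conjI ballI)
    show "comp v \<noteq> {}" using self by blast
    fix a b assume a: "a \<in> comp v" and b: "b \<in> comp v"
    then have "(a, b) \<in> R\<^sup>*"
      using comp_eq[OF a] by (auto simp: comp_def)
    then show "(a, b) \<in> {(a, b). {a, b} \<in> sub (comp v)}\<^sup>*"
    proof (induction rule: rtrancl_induct)
      case (step y z)
      have "y \<in> comp v"
        using step(1) comp_eq[OF a] by (auto simp: comp_def)
      then have "{y, z} \<in> sub (comp v)"
        using edge_comp[of "{y, z}" y] step(2) comp_eq by (auto simp: R_def)
      then show ?case
        using step(3) by (auto intro: rtrancl_into_rtrancl)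
    qed simp
  qed
  have "V = (\<Union>(W, F)\<in>\<G>. W)"
    using self compV by (auto simp: \<G>_def)
  moreover have "E = (\<Union>(W, F)\<in>\<G>. F)"
  proof
    show "E \<subseteq> (\<Union>(W, F)\<in>\<G>. F)"
    proof
      fix e assume e: "e \<in> E"
      then have "card e = 2" "e \<subseteq> V" using G by (auto simp: simple_graph_def)
      then obtain v where "v \<in> e" "v \<in> V" by (auto simp: card_2_iff)
      then show "e \<in> (\<Union>(W, F)\<in>\<G>. F)"
        using edge_comp[OF e] by (auto simp: \<G>_def)
    qed
    show "(\<Union>(W, F)\<in>\<G>. F) \<subseteq> E"
      by (auto simp: \<G>_def sub_def)
  qed
  moreover have "fst H \<inter> fst H' = {}" if "H \<in> \<G>" "H' \<in> \<G>" "H \<noteq> H'" for H H'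
  proof -
    obtain v v' where v: "H = (comp v, sub (comp v))" "H' = (comp v', sub (comp v'))"
      using \<open>H \<in> \<G>\<close> \<open>H' \<in> \<G>\<close> by (auto simp: \<G>_def)
    then have "comp v \<noteq> comp v'"
      using \<open>H \<noteq> H'\<close> by auto
    then have "comp v \<inter> comp v' = {}"
      using comp_eq by blast
    then show ?thesis using v by simp
  qed
  ultimately have "disjoint_union \<G> V E"
    unfolding disjoint_union_def using simple by (auto simp: \<G>_def)
  then show thesis
    using that simple conn by (auto simp: \<G>_def)
qed

section \<open>Coordinates for spiked cycles\<close>

lemma periodic_mod:
  fixes f :: "nat \<Rightarrow> 'b"
  assumes "\<And>i. f (i + n) = f i"
  shows "f (i mod n) = f i"
proof -
  have "f (j + m * n) = f j" for j m
    by (induction m arbitrary: j) (simp_all add: assms add.assoc[symmetric])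
  then have "f (i mod n + i div n * n) = f (i mod n)" .
  then show ?thesis by simp
qed

text \<open>The points \<open>x i\<close> are the vertices of the cycle and \<open>l i\<close> is the leaf attached to \<open>x i\<close>. Indices run through
all naturals and are meant modulo \<open>n\<close>, which avoids reductions in the conditions. The four
conditions correspond to the paths of length three with no leaf, with a leaf at the beginning, with
a leaf at the end, and with leaves at both ends. In a triangle four consecutive vertices are not
distinct, so the first condition is only imposed for \<open>n \<noteq> 3\<close>.\<close>

definition spiked_drawing :: "nat \<Rightarrow> (nat \<Rightarrow> complex) \<Rightarrow> (nat \<Rightarrow> complex) \<Rightarrow> bool" where
  "spiked_drawing n x l \<longleftrightarrow> (\<forall>i. x (i + n) = x i) \<and> (\<forall>i. l (i + n) = l i) \<and>
     (\<forall>i. (n \<noteq> 3 \<longrightarrow> strictly_cross (x i) (x (Suc i)) (x (Suc (Suc i))) (x (Suc (Suc (Suc i))))) \<and>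
       strictly_cross (l i) (x i) (x (Suc i)) (x (Suc (Suc i))) \<and>
       strictly_cross (x i) (x (Suc i)) (x (Suc (Suc i))) (l (Suc (Suc i))) \<and>
       strictly_cross (l i) (x i) (x (Suc i)) (l (Suc i)))"

text \<open>The centroid of this triangle is the origin. An edge from a vertex to the opposite point
prolongs a median: it passes through the midpoint of the opposite side, and any two of them
meet in the centroid.\<close>

lemma spiked_drawing_triangle: "\<exists>x l. spiked_drawing 3 x l"
proof -
  define x where "x i = (if i mod 3 = 0 then Complex 2 (-1)
    else if i mod 3 = 1 then Complex (-1) 2 else Complex (-1) (-1))" for i :: nat
  define l where "l i = - x i" for i
  have "strictly_cross (l i) (x i) (x (Suc i)) (x (Suc (Suc i))) \<and>
    strictly_cross (x i) (x (Suc i)) (x (Suc (Suc i))) (l (Suc (Suc i))) \<and>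
    strictly_cross (l i) (x i) (x (Suc i)) (l (Suc i))" for i
  proof -
    consider "i mod 3 = 0" | "i mod 3 = 1" | "i mod 3 = 2" by linarith
    then show ?thesis
      by cases (simp_all add: x_def l_def mod_Suc strictly_cross_def orient_def)
  qed
  then have "spiked_drawing 3 x l"
    by (simp add: spiked_drawing_def x_def l_def)
  then show ?thesis by blast
qed

text \<open>Segments \<open>ab\<close> and \<open>cd\<close> cross, and the path \<open>a, b, c, d\<close> turns left at both inner vertices. For crossing
segments the two turns agree, so the choice of direction is merely a normalisation.\<close>

definition left_zigzag :: "complex \<Rightarrow> complex \<Rightarrow> complex \<Rightarrow> complex \<Rightarrow> bool" where
  "left_zigzag a b c d \<longleftrightarrow>
     orient a b c > 0 \<and> orient b c d > 0 \<and> orient a b d < 0 \<and> orient a c d < 0"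

lemma zigzag_strictly_cross:
  assumes "left_zigzag a b c d"
  shows "strictly_cross a b c d"
proof -
  have "orient c d a = orient a c d" "orient c d b = orient b c d"
    by (rule orient_rotate, rule orient_rotate)
  then show ?thesis
    using assms by (simp add: left_zigzag_def strictly_cross_def mult_less_0_iff)
qed

text \<open>The leaf of \<open>x\<^sub>i\<close> is placed at \<open>x\<^sub>i\<^sub>+\<^sub>1 + t (x\<^sub>i\<^sub>+\<^sub>2 - x\<^sub>i)\<close> for a small positive \<open>t\<close>. Being close to
the edge \<open>x\<^sub>i x\<^sub>i\<^sub>+\<^sub>1\<close>, the new edge crosses whatever that edge crosses, by continuity. New crossings
are required only with the edges from \<open>x\<^sub>i\<^sub>+\<^sub>1\<close> to \<open>x\<^sub>i\<^sub>+\<^sub>2\<close> and to the leaf near \<open>x\<^sub>i\<^sub>+\<^sub>2\<close>. The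
direction of the shift achieves both, because the leaf lies to the left of the line
\<open>x\<^sub>i x\<^sub>i\<^sub>+\<^sub>1\<close> and, seen from \<open>x\<^sub>i\<close>, beyond the line \<open>x\<^sub>i\<^sub>+\<^sub>1 x\<^sub>i\<^sub>+\<^sub>2\<close>.\<close>

lemma spiked_drawing_of_zigzags:
  assumes per: "\<And>i. x (i + n) = x i" and n: "n > 0"
    and turn: "\<And>i. left_zigzag (x i) (x (Suc i)) (x (Suc (Suc i))) (x (Suc (Suc (Suc i))))"
  shows "\<exists>l. spiked_drawing n x l"
proof -
  define l where "l t i = x (Suc i) + t *\<^sub>R (x (Suc (Suc i)) - x i)" for t i
  define P where "P t i \<longleftrightarrow>
    strictly_cross (l t i) (x i) (x (Suc i)) (x (Suc (Suc i))) \<and>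
    strictly_cross (x i) (x (Suc i)) (x (Suc (Suc i))) (l t (Suc (Suc i))) \<and>
    strictly_cross (l t i) (x i) (x (Suc i)) (l t (Suc i))" for t i
  have lim: "((\<lambda>t. l t i) \<longlongrightarrow> x (Suc i)) (at_right 0)" for i
  proof -
    have "((\<lambda>t. x (Suc i) + t *\<^sub>R (x (Suc (Suc i)) - x i))
      \<longlongrightarrow> x (Suc i) + 0 *\<^sub>R (x (Suc (Suc i)) - x i)) (at_right 0)"
      by (intro tendsto_intros)
    then show ?thesis by (simp add: l_def)
  qed
  have ev: "eventually (\<lambda>t. P t i) (at_right 0)" for i
  proof -
    define a b c where "a = x i" and "b = x (Suc i)" and "c = x (Suc (Suc i))"
    let ?l = "\<lambda>t. l t i" and ?m = "\<lambda>t. l t (Suc i)"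
    have abc: "orient a b c > 0"
      using turn[of i] by (simp add: left_zigzag_def a_def b_def c_def)
    have L: "(?l \<longlongrightarrow> b) (at_right 0)" and M: "(?m \<longlongrightarrow> c) (at_right 0)"
      using lim by (simp_all add: b_def c_def)
    have const: "((\<lambda>t. z) \<longlongrightarrow> z) (at_right (0::real))" for z :: complex
      by (rule tendsto_const)
    have neg: "orient b a c < 0" "orient 0 (c - b) (c - a) < 0" and pos: "orient b c a > 0"
      using abc by (simp_all add: orient_def algebra_simps)
    have 1: "eventually (\<lambda>t. orient (?l t) a c < 0) (at_right 0)"
      by (rule order_tendstoD(2)[OF tendsto_orient[OF L const const] neg(1)])
    have 2: "eventually (\<lambda>t. orient (?l t) a (?m t) < 0) (at_right 0)"
      by (rule order_tendstoD(2)[OF tendsto_orient[OF L const M] neg(1)])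
    have 3: "eventually (\<lambda>t. orient b (?m t) a > 0) (at_right 0)"
      by (rule order_tendstoD(1)[OF tendsto_orient[OF const M const] pos])
    have 4: "eventually (\<lambda>t. orient 0 (?m t - b) (c - a) < 0) (at_right 0)"
      by (rule order_tendstoD(2)[OF tendsto_orient[OF const tendsto_diff[OF M const] const] neg(2)])
    have 5: "eventually (\<lambda>t. strictly_cross a b c (l t (Suc (Suc i)))) (at_right 0)"
      by (rule eventually_strictly_cross[OF const const const lim])
         (use turn[of i] in \<open>auto simp: a_def b_def c_def intro: zigzag_strictly_cross\<close>)
    have 6: "eventually (\<lambda>t::real. t > 0) (at_right 0)"
      by (rule eventually_at_right_less)
    show ?thesis
      using 1 2 3 4 5 6
    proof eventually_elim
      case (elim t)
      have l: "l t i = b + t *\<^sub>R (c - a)"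
        by (simp add: l_def a_def b_def c_def)
      \<comment> \<open>The orientations that vanish for \<open>t = 0\<close>: here the factor \<open>t\<close> can be split off.\<close>
      have eqs: "orient (l t i) a b = t * orient a b c"
        "orient b c (l t i) = - (t * orient a b c)"
        "orient b (l t (Suc i)) (l t i) = t * orient 0 (l t (Suc i) - b) (c - a)"
        by (simp_all add: l orient_def algebra_simps)
      have "strictly_cross (l t i) a b c"
        using elim abc pos unfolding strictly_cross_def eqs
        by (auto simp: mult_less_0_iff zero_less_mult_iff)
      moreover have "strictly_cross (l t i) a b (l t (Suc i))"
        using elim abc unfolding strictly_cross_def eqs
        by (auto simp: mult_less_0_iff zero_less_mult_iff)
      ultimately show ?case
        using elim(5) by (simp add: P_def a_def b_def c_def)
    qed
  qed
  have "eventually (\<lambda>t. \<forall>i\<in>{..<n}. P t i) (at_right 0)"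
    by (rule eventually_ball_finite) (use ev in auto)
  then obtain t where t: "\<forall>i\<in>{..<n}. P t i"
    using eventually_happens'[of "at_right (0::real)"] by force
  have xmod: "x (i mod n) = x i" "x (Suc (i mod n)) = x (Suc i)"
    "x (Suc (Suc (i mod n))) = x (Suc (Suc i))"
    "x (Suc (Suc (Suc (i mod n)))) = x (Suc (Suc (Suc i)))"
    "x (Suc (Suc (Suc (Suc (i mod n))))) = x (Suc (Suc (Suc (Suc i))))" for i
    using periodic_mod[of x n, OF per]
      periodic_mod[of "\<lambda>i. x (Suc i)" n] periodic_mod[of "\<lambda>i. x (Suc (Suc i))" n]
      periodic_mod[of "\<lambda>i. x (Suc (Suc (Suc i)))" n]
      periodic_mod[of "\<lambda>i. x (Suc (Suc (Suc (Suc i))))" n] per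
    by (simp_all only: add_Suc[symmetric])
  have "P t i" for i
  proof -
    have "P t (i mod n)" using t n by simp
    then show ?thesis by (simp only: P_def l_def xmod)
  qed
  moreover have "l t (i + n) = l t i" for i
    using per[of i] per[of "Suc i"] per[of "Suc (Suc i)"] by (simp add: l_def)
  ultimately have "spiked_drawing n x (l t)"
    unfolding spiked_drawing_def P_def
    using per turn zigzag_strictly_cross by blast
  then show ?thesis by blast
qed

text \<open>A closed zigzag of length \<open>n\<close> whose first five points can be traversed cyclically as well. The last
three conditions are the zigzags that arise when the point after \<open>x 4\<close> is \<open>x 0\<close> again.\<close>

definition star_sequence :: "nat \<Rightarrow> (nat \<Rightarrow> complex) \<Rightarrow> bool" where
  "star_sequence n x \<longleftrightarrow> (\<forall>i. x (i + n) = x i) \<and>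
     (\<forall>i. left_zigzag (x i) (x (i + 1)) (x (i + 2)) (x (i + 3))) \<and>
     left_zigzag (x 2) (x 3) (x 4) (x 0) \<and> left_zigzag (x 3) (x 4) (x 0) (x 1) \<and>
     left_zigzag (x 4) (x 0) (x 1) (x 2)"

text \<open>The new sequence runs through \<open>x 0, ..., x 4\<close> and then through the whole old sequence. Each of its
windows of four points is a window of the old sequence or of the closed walk through the first
five points.\<close>

lemma star_sequence_extend:
  assumes "star_sequence n x"
  shows "\<exists>y. star_sequence (n + 5) y"
proof -
  define y where "y i = (let j = i mod (n + 5) in if j < 5 then x j else x (j - 5))" for i
  have per: "x (i + n) = x i" and turn: "left_zigzag (x i) (x (i + 1)) (x (i + 2)) (x (i + 3))" for i
    using assms by (auto simp: star_sequence_def)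
  have close: "left_zigzag (x 2) (x 3) (x 4) (x 0)" "left_zigzag (x 3) (x 4) (x 0) (x 1)"
    "left_zigzag (x 4) (x 0) (x 1) (x 2)"
    using assms by (auto simp: star_sequence_def)
  have low: "y m = x m" if "m < 5" for m
    using that by (simp add: y_def)
  have high: "y (5 + m) = x m" if "m < n + 5" for m
  proof (cases "m < n")
    case True
    then show ?thesis by (simp add: y_def)
  next
    case False
    define t where "t = m - n"
    have t: "m = n + t" "t < 5"
      using False that by (auto simp: t_def)
    then have "(5 + m) mod (n + 5) = t"
      by (simp add: mod_if)
    then show ?thesis
      using t per[of t] by (simp add: y_def add.commute)
  qed
  have yper: "y (i + (n + 5)) = y i" for i
    by (simp add: y_def)
  have yturn: "left_zigzag (y i) (y (i + 1)) (y (i + 2)) (y (i + 3))" if "i < n + 5" for i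
  proof (cases "i < 5")
    case True
    have vals: "y 0 = x 0" "y 1 = x 1" "y 2 = x 2" "y 3 = x 3" "y 4 = x 4"
      "y 5 = x 0" "y 6 = x 1" "y 7 = x 2"
      using low high[of 0] high[of 1] high[of 2] by simp_all
    consider "i = 0" | "i = 1" | "i = 2" | "i = 3" | "i = 4"
      using True by linarith
    then show ?thesis
      using turn[of 0] turn[of 1] close
      by cases (simp_all add: vals del: One_nat_def add_2_eq_Suc add_2_eq_Suc')
  next
    case False
    then obtain m where m: "i = 5 + m" using le_Suc_ex not_less by blast
    then have "y i = x m" "y (i + 1) = x (m + 1)" "y (i + 2) = x (m + 2)" "y (i + 3) = x (m + 3)"
      using that high[of m] high[of "m + 1"] high[of "m + 2"] high[of "m + 3"]
      by (simp_all add: add.assoc)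
    then show ?thesis using turn by simp
  qed
  have "left_zigzag (y i) (y (i + 1)) (y (i + 2)) (y (i + 3))" for i
  proof -
    let ?j = "i mod (n + 5)"
    have "y (?j + k) = y (i + k)" for k
      unfolding y_def by (simp add: mod_add_left_eq)
    from this[of 0] this[of 1] this[of 2] this[of 3] show ?thesis
      using yturn[of ?j] by simp
  qed
  then have "star_sequence (n + 5) y"
    unfolding star_sequence_def using yper close low by auto
  then show ?thesis by blast
qed

text \<open>All windows of four consecutive entries of a list are checked; for a closed zigzag the first three
entries are repeated at the end.\<close>

fun left_zigzags :: "complex list \<Rightarrow> bool" where
  "left_zigzags (a # b # c # d # zs) \<longleftrightarrow> left_zigzag a b c d \<and> left_zigzags (b # c # d # zs)"
| "left_zigzags _ \<longleftrightarrow> True"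

lemma left_zigzags_nth:
  assumes "left_zigzags zs" "i + 3 < length zs"
  shows "left_zigzag (zs ! i) (zs ! (i + 1)) (zs ! (i + 2)) (zs ! (i + 3))"
  using assms
proof (induction zs arbitrary: i rule: left_zigzags.induct)
  case (1 a b c d zs)
  show ?case
  proof (cases i)
    case 0
    then show ?thesis using 1(2) by (simp add: numeral_eq_Suc)
  next
    case (Suc j)
    then show ?thesis using 1(1)[of j] 1(2,3) by simp
  qed
qed auto

lemma star_sequence_of_list:
  assumes len: "length zs = n" "5 \<le> n"
    and left_zigzags: "left_zigzags (zs @ take 3 zs)" "left_zigzags (drop 2 (take 5 zs) @ take 3 zs)"
  shows "\<exists>x. star_sequence n x"
proof -
  define x where "x i = zs ! (i mod n)" for i
  have wrap: "(zs @ take 3 zs) ! j = x j" if "j < n + 3" for j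
    using that len by (auto simp: x_def nth_append mod_if)
  have turn: "left_zigzag (x i) (x (i + 1)) (x (i + 2)) (x (i + 3))" if "i < n" for i
    using left_zigzags_nth[OF left_zigzags(1), of i] that len wrap[of i] wrap[of "i + 1"]
      wrap[of "i + 2"] wrap[of "i + 3"] by simp
  have "left_zigzag (x i) (x (i + 1)) (x (i + 2)) (x (i + 3))" for i
  proof -
    have "x (i mod n + k) = x (i + k)" for k
      by (simp add: x_def mod_add_left_eq)
    from this[of 0] this[of 1] this[of 2] this[of 3] show ?thesis
      using turn[of "i mod n"] len by simp
  qed
  moreover have "left_zigzag (x 2) (x 3) (x 4) (x 0)" "left_zigzag (x 3) (x 4) (x 0) (x 1)"
    "left_zigzag (x 4) (x 0) (x 1) (x 2)"
  proof -
    let ?w = "drop 2 (take 5 zs) @ take 3 zs"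
    have "?w ! 0 = x 2" "?w ! 1 = x 3" "?w ! 2 = x 4" "?w ! 3 = x 0" "?w ! 4 = x 1" "?w ! 5 = x 2"
      using len by (simp_all add: nth_append x_def)
    then show "left_zigzag (x 2) (x 3) (x 4) (x 0)" "left_zigzag (x 3) (x 4) (x 0) (x 1)"
      "left_zigzag (x 4) (x 0) (x 1) (x 2)"
      using left_zigzags_nth[OF left_zigzags(2), of 0] left_zigzags_nth[OF left_zigzags(2), of 1]
        left_zigzags_nth[OF left_zigzags(2), of 2] len
      by (simp_all del: One_nat_def add_2_eq_Suc add_2_eq_Suc')
  qed
  moreover have "x (i + n) = x i" for i
    by (simp add: x_def)
  ultimately have "star_sequence n x"
    by (simp add: star_sequence_def)
  then show ?thesis by blast
qed

text \<open>The five lists of coordinates are starting points for the residue classes modulo 5. The class of 1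
starts at 11, as length 6 is impossible.\<close>

lemma star_sequence_5: "\<exists>x. star_sequence 5 x"
  by (rule star_sequence_of_list[of "[Complex 4 4, Complex 1 0, Complex 3 1, Complex 0 4, Complex 2 0]"])
     (simp_all add: left_zigzag_def orient_def)

lemma star_sequence_7: "\<exists>x. star_sequence 7 x"
  by (rule star_sequence_of_list[of "[Complex 4 8, Complex 1 2, Complex 6 6, Complex 0 7,
        Complex 8 3, Complex 3 8, Complex 6 1]"])
     (simp_all add: left_zigzag_def orient_def)

lemma star_sequence_8: "\<exists>x. star_sequence 8 x"
  by (rule star_sequence_of_list[of "[Complex 2 8, Complex 3 2, Complex 6 9, Complex 1 7,
        Complex 5 4, Complex 4 9, Complex 2 5, Complex 9 3]"])
     (simp_all add: left_zigzag_def orient_def)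

lemma star_sequence_9: "\<exists>x. star_sequence 9 x"
  by (rule star_sequence_of_list[of "[Complex 0 8, Complex 12 6, Complex 0 9, Complex 7 0,
        Complex 4 10, Complex 5 1, Complex 10 10, Complex 2 6, Complex 12 10]"])
     (simp_all add: left_zigzag_def orient_def)

lemma star_sequence_11: "\<exists>x. star_sequence 11 x"
  by (rule star_sequence_of_list[of "[Complex 6 4, Complex 5 15, Complex 3 5, Complex 16 16,
        Complex 3 8, Complex 14 12, Complex 4 12, Complex 15 5, Complex 3 14, Complex 11 5,
        Complex 4 15]"])
     (simp_all add: left_zigzag_def orient_def)

text \<open>Every admissible length arises from one of 5, 7, 8, 9 and 11 by adding a multiple of five.\<close>

lemma star_sequence_exists:
  assumes "n = 5 \<or> 7 \<le> n"
  shows "\<exists>x. star_sequence n x"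
  using assms
proof (induction n rule: less_induct)
  case (less n)
  consider "n \<in> {5, 7, 8, 9, 11}" | "n = 10 \<or> 12 \<le> n"
    using less.prems by fastforce
  then show ?case
  proof cases
    case 1
    then show ?thesis
      using star_sequence_5 star_sequence_7 star_sequence_8 star_sequence_9 star_sequence_11
      by auto
  next
    case 2
    then have "\<exists>x. star_sequence (n - 5) x"
      by (intro less.IH) auto
    then have "\<exists>x. star_sequence (n - 5 + 5) x"
      using star_sequence_extend by blast
    then show ?thesis using 2 by auto
  qed
qed

lemma spiked_drawing_exists:
  assumes "n = 3 \<or> n = 5 \<or> 7 \<le> n"
  shows "\<exists>x l. spiked_drawing n x l"
proof (cases "n = 3")
  case True
  then show ?thesis using spiked_drawing_triangle by blast
next
  case False
  then obtain x where "star_sequence n x"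
    using star_sequence_exists assms by blast
  then have "\<And>i. x (i + n) = x i"
    "\<And>i. left_zigzag (x i) (x (Suc i)) (x (Suc (Suc i))) (x (Suc (Suc (Suc i))))"
    by (simp_all add: star_sequence_def numeral_eq_Suc)
  then show ?thesis
    using spiked_drawing_of_zigzags[of x n] assms by fastforce
qed

text \<open>The vertices in \<open>S\<close> are embedded into the cycle of length \<open>n\<close>, and every other vertex takes the place of
the leaf at its only neighbour. A path of length three then becomes a path of the spiked cycle:
its inner vertices belong to \<open>S\<close> as they have two neighbours, and injectivity of the index prevents
it from running back. Since edges of the cycle may be absent from \<open>E\<close>, caterpillars and spiked
cycles are covered alike.\<close>

lemma labelled_paths_cross:
  assumes D: "spiked_drawing n x l"
    and idx: "inj_on idx S" "\<And>v. v \<in> S \<Longrightarrow> idx v < n"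
    and spine: "\<And>u v. \<lbrakk>{u, v} \<in> E; u \<in> S; v \<in> S\<rbrakk> \<Longrightarrow>
      idx v = Suc (idx u) mod n \<or> idx u = Suc (idx v) mod n"
    and inner: "\<And>u v w. \<lbrakk>{u, v} \<in> E; {u, w} \<in> E; v \<noteq> w\<rbrakk> \<Longrightarrow> u \<in> S"
  shows "\<exists>p. paths_cross E p"
proof -
  define p where "p v = (if v \<in> S then x (idx v) else l (idx (SOME c. {v, c} \<in> E)))" for v
  have pS: "p v = x (idx v)" if "v \<in> S" for v
    using that by (simp add: p_def)
  have pleaf: "p v = l (idx c)" if "v \<notin> S" "{v, c} \<in> E" for v c
  proof -
    have "{v, SOME c. {v, c} \<in> E} \<in> E"
      using that(2) by (rule someI)
    then have "(SOME c. {v, c} \<in> E) = c"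
      using inner that by blast
    then show ?thesis using that by (simp add: p_def)
  qed
  have xper: "\<And>i. x (i + n) = x i" and lper: "\<And>i. l (i + n) = l i"
    using D by (simp_all add: spiked_drawing_def)
  have xmod: "x (i mod n) = x i" and lmod: "l (i mod n) = l i" for i
    using periodic_mod[of x n, OF xper] periodic_mod[of l n, OF lper] by simp_all
  have A: "n \<noteq> 3 \<Longrightarrow> strictly_cross (x i) (x (Suc i)) (x (Suc (Suc i))) (x (Suc (Suc (Suc i))))"
    and B: "strictly_cross (l i) (x i) (x (Suc i)) (x (Suc (Suc i)))"
    and C: "strictly_cross (x i) (x (Suc i)) (x (Suc (Suc i))) (l (Suc (Suc i)))"
    and D': "strictly_cross (l i) (x i) (x (Suc i)) (l (Suc i))" for i
    using D by (simp_all add: spiked_drawing_def)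
  have eq: "a = b" if "a \<in> S" "b \<in> S" "idx a = idx b" for a b
    using inj_onD[OF idx(1) that(3,1,2)] .
  \<comment> \<open>By reversing the path one may assume that the index increases along its middle edge.\<close>
  have forward: "strictly_cross (p u) (p v) (p w) (p z)"
    if P: "path3 E u v w z" and vw: "v \<in> S" "w \<in> S" "idx w = Suc (idx v) mod n" for u v w z
  proof -
    have E: "{u, v} \<in> E" "{v, w} \<in> E" "{w, z} \<in> E" "{v, u} \<in> E" "{z, w} \<in> E"
      and dist: "u \<noteq> w" "v \<noteq> z" "u \<noteq> z"
      using P by (auto simp: path3_def insert_commute)
    let ?i = "idx v"
    have pv: "p v = x ?i" and pw: "p w = x (Suc ?i)"
      using vw by (simp_all add: pS xmod)
    have n: "n > 0" using idx(2)[OF vw(1)] by simp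
    have z: "if z \<in> S then idx z = Suc (Suc ?i mod n) mod n else p z = l (Suc ?i)"
    proof (cases "z \<in> S")
      case True
      have "idx w \<noteq> Suc (idx z) mod n"
        using Suc_mod_eq_iff[of "idx v" n "idx z"] idx(2) vw True dist(2) eq[of v z] by auto
      then show ?thesis
        using spine[OF E(3) vw(2) True] vw(3) True by auto
    next
      case False
      then show ?thesis
        using pleaf[OF False E(5)] vw(3) by (simp add: lmod)
    qed
    have pz: "p z = x (Suc (Suc ?i))" if "z \<in> S"
    proof -
      have "p z = x (Suc (Suc ?i mod n) mod n)"
        using pS[OF that] z that by simp
      also have "\<dots> = x (Suc (Suc ?i))"
        by (simp only: mod_Suc_eq xmod)
      finally show ?thesis .
    qed
    show ?thesis
    proof (cases "u \<in> S")
      case False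
      then have pu: "p u = l ?i"
        using pleaf[OF False E(1)] by simp
      show ?thesis
        using B[of ?i] D'[of ?i] z pz by (cases "z \<in> S") (simp_all add: pu pv pw)
    next
      case True
      have "idx u \<noteq> Suc ?i mod n"
        using vw eq[OF True vw(2)] dist(1) by auto
      then have i: "?i = Suc (idx u) mod n"
        using spine[OF E(1) True vw(1)] by auto
      let ?j = "idx u"
      have pu: "p u = x ?j" using True by (rule pS)
      have shift: "x (Suc ?i) = x (Suc (Suc ?j))"
        "x (Suc (Suc ?i)) = x (Suc (Suc (Suc ?j)))" "l (Suc ?i) = l (Suc (Suc ?j))"
        "x ?i = x (Suc ?j)"
        unfolding i using xper lper periodic_mod[of "\<lambda>i. x (Suc i)" n]
          periodic_mod[of "\<lambda>i. x (Suc (Suc i))" n] periodic_mod[of "\<lambda>i. l (Suc i)" n]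
        by (simp_all only: add_Suc[symmetric] xmod)
      show ?thesis
      proof (cases "z \<in> S")
        case False
        then show ?thesis
          using C[of ?j] z by (simp add: pu pv pw shift)
      next
        case zS: True
        have "n \<noteq> 3"
        proof
          assume "n = 3"
          then have "idx z = idx u"
            using z zS i idx(2)[OF True] by (auto simp: mod_Suc split: if_splits)
          then show False
            using eq[OF zS True] dist(3) by simp
        qed
        then show ?thesis
          using A[of ?j] by (simp add: pu pv pw pz[OF zS] shift)
      qed
    qed
  qed
  have "strictly_cross (p u) (p v) (p w) (p z)" if P: "path3 E u v w z" for u v w z
  proof -
    have E: "{v, u} \<in> E" "{v, w} \<in> E" "{w, v} \<in> E" "{w, z} \<in> E"
      and dist: "u \<noteq> w" "v \<noteq> z"
      using P by (auto simp: path3_def insert_commute)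
    have "v \<in> S" "w \<in> S"
      using inner[OF E(1,2) dist(1)] inner[OF E(3,4) dist(2)] by simp_all
    then show ?thesis
      using spine[OF E(2)] forward[OF P] forward[of z w v u] P path3_rev strictly_cross_rev
      by metis
  qed
  then have "paths_cross E p"
    by (simp add: paths_cross_def)
  then show ?thesis by blast
qed

section \<open>Drawing caterpillars, spiked cycles and disjoint unions\<close>

text \<open>A segment of the path together with the chord is a cycle. Therefore an acyclic graph has no chord,
and in a graph with a unique cycle every chord belongs to this cycle.\<close>

lemma chord_cycle:
  assumes vs: "distinct vs" and ij: "Suc i < j" "j < length vs"
    and steps: "\<And>k. Suc k < length vs \<Longrightarrow> {vs ! k, vs ! Suc k} \<in> E"
    and chord: "{vs ! i, vs ! j} \<in> E"
  shows "\<exists>C\<in>cycles E. {vs ! i, vs ! j} \<in> C"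
proof -
  let ?n = "Suc j - i"
  define ws where "ws = take ?n (drop i vs)"
  have len: "length ws = ?n" using ij by (simp add: ws_def)
  have nth: "ws ! k = vs ! (i + k)" if "k < ?n" for k
    using that ij by (simp add: ws_def)
  have ws: "distinct ws" "3 \<le> length ws"
    using vs ij len by (simp_all add: ws_def)
  have last: "ws ! (j - i) = vs ! j" "ws ! 0 = vs ! i"
    using nth[of "j - i"] nth[of 0] ij by simp_all
  have edge: "{ws ! k, ws ! (Suc k mod ?n)} \<in> E" if k: "k < ?n" for k
  proof (cases "k = j - i")
    case True
    then have "Suc k mod ?n = 0" using ij by (simp add: Suc_diff_le)
    then show ?thesis
      using True last chord by (simp add: insert_commute)
  next
    case False
    then have "Suc k < ?n" using k by simp
    then show ?thesis
      using nth[of k] nth[of "Suc k"] steps[of "i + k"] ij k by simp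
  qed
  have "cyc ws \<subseteq> E"
    unfolding cyc_def len using edge by auto
  then have "cyc ws \<in> cycles E"
    using ws by (auto simp: cycles_iff)
  moreover have "{ws ! (j - i), ws ! (Suc (j - i) mod length ws)} \<in> cyc ws"
    using len ij by (auto simp: cyc_def)
  then have "{vs ! i, vs ! j} \<in> cyc ws"
    using last len ij by (simp add: insert_commute Suc_diff_le)
  ultimately show ?thesis by blast
qed

lemma nth_index:
  assumes "distinct vs"
  shows "\<exists>idx. inj_on idx (set vs) \<and> (\<forall>v\<in>set vs. idx v < length vs \<and> vs ! idx v = v)"
proof -
  have "\<forall>v\<in>set vs. \<exists>i. i < length vs \<and> vs ! i = v"
    by (simp add: in_set_conv_nth)
  then obtain idx where idx: "\<forall>v\<in>set vs. idx v < length vs \<and> vs ! idx v = v"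
    by metis
  then have "inj_on idx (set vs)"
    by (intro inj_on_inverseI[of _ "\<lambda>i. vs ! i"]) blast
  then show ?thesis using idx by blast
qed

text \<open>An edge between two vertices of the cycle is an edge of the cycle, since a chord would give a second
cycle; every other edge ends in a leaf.\<close>

lemma spiked_cycle_paths_cross:
  assumes G: "simple_graph V E" and spiked: "spiked_cycle V E n" and D: "spiked_drawing n x l"
  shows "\<exists>p. paths_cross E p"
proof -
  obtain C where C: "cycles E = {C}" "card C = n" "\<And>v. v \<in> V - \<Union>C \<Longrightarrow> degree E v = 1"
    using spiked unfolding spiked_cycle_def by blast
  then have "C \<in> cycles E" by simp
  then obtain vs where vs: "distinct vs" "3 \<le> length vs" "C = cyc vs" "C \<subseteq> E"
    by (auto simp: cycles_iff)
  have n: "length vs = n" using card_cyc[OF vs(1,2)] vs(3) C(2) by simp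
  obtain idx where idx: "inj_on idx (set vs)"
    "\<And>v. v \<in> set vs \<Longrightarrow> idx v < length vs \<and> vs ! idx v = v"
    using nth_index[OF vs(1)] by blast
  have steps: "{vs ! k, vs ! Suc k} \<in> C" if "Suc k < length vs" for k
    using that cyc_edge_iff[OF vs(1), of k "Suc k"] vs(3) by simp
  then have steps': "{vs ! k, vs ! Suc k} \<in> E" if "Suc k < length vs" for k
    using that vs(4) by blast
  have ordered: "{vs ! i, vs ! j} \<in> C"
    if "i < j" "j < length vs" "{vs ! i, vs ! j} \<in> E" for i j
  proof (cases "j = Suc i")
    case True
    then show ?thesis using steps that by simp
  next
    case False
    then have "Suc i < j" using that by simp
    then have "\<exists>C'\<in>cycles E. {vs ! i, vs ! j} \<in> C'"
      by (rule chord_cycle[OF vs(1) _ that(2) steps' that(3)])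
    then show ?thesis using C(1) by simp
  qed
  show ?thesis
  proof (rule labelled_paths_cross[OF D idx(1)])
    show "idx v < n" if "v \<in> set vs" for v
      using idx(2)[OF that] n by simp
    show "idx v = Suc (idx u) mod n \<or> idx u = Suc (idx v) mod n"
      if uv: "{u, v} \<in> E" "u \<in> set vs" "v \<in> set vs" for u v
    proof -
      have u: "idx u < length vs" "vs ! idx u = u" and v: "idx v < length vs" "vs ! idx v = v"
        using idx(2) uv by blast+
      have "u \<noteq> v" using edge_props(3)[OF G uv(1)] .
      then have "idx u < idx v \<or> idx v < idx u"
        using u v by (metis nat_neq_iff)
      then have "{vs ! idx u, vs ! idx v} \<in> C"
        using ordered[of "idx u" "idx v"] ordered[of "idx v" "idx u"] u v uv(1)
        by (auto simp: insert_commute)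
      then show ?thesis
        using cyc_edge_iff[OF vs(1) u(1) v(1)] vs(3) n by simp
    qed
    show "u \<in> set vs" if "{u, v} \<in> E" "{u, w} \<in> E" "v \<noteq> w" for u v w
      using degree_ne_1[OF G that] C(3)[of u] edge_props(1)[OF G that(1)] vs(3) Union_cyc[of vs]
      by blast
  qed
qed

text \<open>A longest path among the vertices that are not leaves contains all of them. Indeed, a further such
neighbour of an end of the path would extend it, and a further one of an inner vertex would be its
third. So the path together with the leaves attached to it is closed under adjacency.\<close>

lemma caterpillar_spine:
  assumes G: "simple_graph V E" and cat: "caterpillar V E"
  obtains us where "distinct us" "set us = {v \<in> V. degree E v \<noteq> 1}"
    "successively (\<lambda>u v. {u, v} \<in> E) us"
proof -
  define S where "S = {v \<in> V. degree E v \<noteq> 1}"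
  define P where "P us \<longleftrightarrow> distinct us \<and> set us \<subseteq> S \<and> successively (\<lambda>u v. {u, v} \<in> E) us" for us
  have conn: "connected_graph V E" and two: "\<And>v. v \<in> V \<Longrightarrow> card (inner_neighbours V E v) \<le> 2"
    using cat by (auto simp: caterpillar_def tree_def)
  have fin: "finite V" "finite S"
    using G by (auto simp: simple_graph_def S_def)
  have bound: "length us \<le> card S" if "P us" for us
    using that card_mono[OF fin(2), of "set us"] distinct_card[of us] by (auto simp: P_def)
  have "P []" by (simp add: P_def)
  moreover have "\<forall>us. P us \<longrightarrow> length us < Suc (card S)"
    using bound by (simp add: less_Suc_eq_le)
  ultimately have "\<exists>us. P us \<and> (\<forall>ws. P ws \<longrightarrow> length ws \<le> length us)"
    by (rule ex_has_greatest_nat)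
  then obtain us where us: "P us" and max: "\<And>ws. P ws \<Longrightarrow> length ws \<le> length us"
    by blast
  have dist: "distinct us" and sub: "set us \<subseteq> S"
    and steps: "\<And>i. Suc i < length us \<Longrightarrow> {us ! i, us ! Suc i} \<in> E"
    using us by (auto simp: P_def successively_conv_nth)
  have no_ext: "w \<in> set us" if w: "w \<in> S" and u: "u \<in> set us" and uw: "{u, w} \<in> E" for u w
  proof (rule ccontr)
    assume new: "w \<notin> set us"
    obtain i where i: "i < length us" "us ! i = u"
      using u by (auto simp: in_set_conv_nth)
    have "i \<noteq> 0"
    proof
      assume "i = 0"
      then have "hd us = u" "us \<noteq> []" using i by (auto simp: hd_conv_nth)
      then have "P (w # us)"
        using us new w uw by (cases us) (auto simp: P_def insert_commute)
      then show False using max by fastforce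
    qed
    then obtain k where k: "i = Suc k" by (cases i) auto
    have "Suc i \<noteq> length us"
    proof
      assume len: "Suc i = length us"
      have "us \<noteq> []" using i by auto
      moreover have "last us = u"
        using i \<open>us \<noteq> []\<close> len[symmetric] by (simp add: last_conv_nth)
      ultimately have "P (us @ [w])"
        using us new w uw by (auto simp: P_def successively_append_iff)
      then show False using max by fastforce
    qed
    then have Si: "Suc i < length us" using i by simp
    let ?a = "us ! k" and ?b = "us ! Suc i"
    have "?a \<in> set us" "?b \<in> set us" using Si k by simp_all
    then have "?a \<in> S" "?b \<in> S" using sub by blast+
    moreover have "{?a, u} \<in> E" "{?b, u} \<in> E" "{w, u} \<in> E"
      using steps[of k] steps[of i] uw Si i k by (simp_all add: insert_commute)
    ultimately have "{?a, ?b, w} \<subseteq> inner_neighbours V E u"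
      using w by (simp add: S_def)
    then have "card {?a, ?b, w} \<le> card (inner_neighbours V E u)"
      using fin by (intro card_mono) simp_all
    moreover have "?a \<noteq> ?b"
      using dist Si k by (simp add: nth_eq_iff_index_eq)
    then have "card {?a, ?b, w} = 3"
      using new \<open>?a \<in> set us\<close> \<open>?b \<in> set us\<close> by (subst card_3_iff) blast
    moreover have "u \<in> V" using edge_props(1)[OF G uw] .
    ultimately show False using two[of u] by simp
  qed
  have "S \<subseteq> set us"
  proof (cases "S = {}")
    case False
    then obtain s where s: "s \<in> S" by blast
    then have "P [s]" by (simp add: P_def)
    then have "us \<noteq> []" using max by fastforce
    define T where "T = set us \<union> {v \<in> V. degree E v = 1 \<and> (\<exists>c\<in>set us. {v, c} \<in> E)}"
    have "T = V"
    proof (rule connected_closed_eq[OF conn])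
      show "T \<subseteq> V" using sub by (auto simp: T_def S_def)
      show "T \<noteq> {}" using \<open>us \<noteq> []\<close> by (auto simp: T_def)
    next
      fix u w assume u: "u \<in> T" and uw: "{u, w} \<in> E"
      have V: "u \<in> V" "w \<in> V" using edge_props[OF G uw] by auto
      show "w \<in> T"
      proof (cases "u \<in> set us")
        case True
        show ?thesis
        proof (cases "degree E w = 1")
          case False
          then have "w \<in> set us"
            using no_ext[of w u] V True uw by (simp add: S_def)
          then show ?thesis by (simp add: T_def)
        next
          case leaf: True
          have "{w, u} \<in> E" using uw by (simp add: insert_commute)
          then show ?thesis using True V leaf by (auto simp: T_def)
        qed
      next
        case False
        then obtain c where c: "degree E u = 1" "c \<in> set us" "{u, c} \<in> E"
          using u by (auto simp: T_def)
        then have "w = c"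
          using degree_ne_1[OF G uw c(3)] by blast
        then show ?thesis using c by (simp add: T_def)
      qed
    qed
    then show ?thesis by (auto simp: T_def S_def)
  qed simp
  then have "set us = S" using sub by blast
  show thesis
  proof (rule that)
    show "distinct us" by (rule dist)
    show "set us = {v \<in> V. degree E v \<noteq> 1}"
      using \<open>set us = S\<close> unfolding S_def .
    show "successively (\<lambda>u v. {u, v} \<in> E) us"
      using us by (simp add: P_def)
  qed
qed

text \<open>The spine is placed on a cycle that is so long that it does not close up.\<close>

lemma caterpillar_paths_cross:
  assumes G: "simple_graph V E" and cat: "caterpillar V E"
  shows "\<exists>p. paths_cross E p"
proof -
  obtain us where us: "distinct us" "set us = {v \<in> V. degree E v \<noteq> 1}"
    and succ: "successively (\<lambda>u v. {u, v} \<in> E) us"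
    using caterpillar_spine[OF G cat] .
  have steps: "{us ! i, us ! Suc i} \<in> E" if "Suc i < length us" for i
    using succ that by (simp add: successively_conv_nth)
  have acyclic: "cycles E = {}"
    using cat by (simp add: caterpillar_def tree_def)
  obtain idx where idx: "inj_on idx (set us)"
    "\<And>v. v \<in> set us \<Longrightarrow> idx v < length us \<and> us ! idx v = v"
    using nth_index[OF us(1)] by blast
  \<comment> \<open>All lengths from 7 on are available.\<close>
  let ?n = "length us + 7"
  obtain x l where D: "spiked_drawing ?n x l"
    using spiked_drawing_exists[of ?n] by auto
  have ordered: "j = Suc i" if "i < j" "j < length us" "{us ! i, us ! j} \<in> E" for i j
  proof (rule ccontr)
    assume "j \<noteq> Suc i"
    then have "Suc i < j" using that by simp
    then show False
      using chord_cycle[OF us(1) _ that(2) steps that(3)] acyclic by simp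
  qed
  show ?thesis
  proof (rule labelled_paths_cross[OF D idx(1)])
    show "idx v < ?n" if "v \<in> set us" for v
      using idx(2)[OF that] by simp
    show "idx v = Suc (idx u) mod ?n \<or> idx u = Suc (idx v) mod ?n"
      if uv: "{u, v} \<in> E" "u \<in> set us" "v \<in> set us" for u v
    proof -
      have u: "idx u < length us" "us ! idx u = u" and v: "idx v < length us" "us ! idx v = v"
        using idx(2) uv by blast+
      have "u \<noteq> v" using edge_props(3)[OF G uv(1)] .
      then have "idx u < idx v \<or> idx v < idx u"
        using u v by (metis nat_neq_iff)
      then have "idx v = Suc (idx u) \<or> idx u = Suc (idx v)"
        using ordered[of "idx u" "idx v"] ordered[of "idx v" "idx u"] u v uv(1)
        by (auto simp: insert_commute)
      then show ?thesis using u v by auto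
    qed
    show "u \<in> set us" if "{u, v} \<in> E" "{u, w} \<in> E" "v \<noteq> w" for u v w
      using degree_ne_1[OF G that] edge_props(1)[OF G that(1)] us(2) by simp
  qed
qed

text \<open>All edges of a path lie in the same part, so placements of the parts can be combined without
regard to their relative position.\<close>

lemma disjoint_union_paths_cross:
  assumes U: "disjoint_union \<G> V E"
    and draw: "\<And>W F. (W, F) \<in> \<G> \<Longrightarrow> \<exists>p. paths_cross F p"
  shows "\<exists>p. paths_cross E p"
proof -
  have "\<forall>H\<in>\<G>. \<exists>p. paths_cross (snd H) p"
    using draw by auto
  then obtain q where q: "\<And>H. H \<in> \<G> \<Longrightarrow> paths_cross (snd H) (q H)"
    by metis
  define part where "part v = (THE H. H \<in> \<G> \<and> v \<in> fst H)" for v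
  have unique: "H = H'" if "H \<in> \<G>" "H' \<in> \<G>" "v \<in> fst H" "v \<in> fst H'" for H H' v
    using U that unfolding disjoint_union_def by blast
  have part: "part v = H" if "H \<in> \<G>" "v \<in> fst H" for H v
    unfolding part_def by (rule the_equality) (use that unique in blast)+
  have edge: "\<exists>H\<in>\<G>. e \<in> snd H \<and> e \<subseteq> fst H" if e: "e \<in> E" for e
  proof -
    have "E = (\<Union>(W, F)\<in>\<G>. F)" and simple: "\<forall>(W, F)\<in>\<G>. simple_graph W F"
      using U by (simp_all add: disjoint_union_def)
    then obtain W F where "(W, F) \<in> \<G>" "e \<in> F" using e by blast
    moreover from this have "simple_graph W F" using simple by blast
    ultimately show ?thesis
      by (intro bexI[of _ "(W, F)"]) (simp_all add: simple_graph_def)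
  qed
  have "paths_cross E (\<lambda>v. q (part v) v)"
    unfolding paths_cross_def
  proof (intro allI impI)
    fix u v w z
    assume P: "path3 E u v w z"
    then have E: "{u, v} \<in> E" "{v, w} \<in> E" "{w, z} \<in> E"
      by (simp_all add: path3_def)
    obtain H1 H2 H3 where H1: "H1 \<in> \<G>" "{u, v} \<in> snd H1" "{u, v} \<subseteq> fst H1"
      and H2: "H2 \<in> \<G>" "{v, w} \<in> snd H2" "{v, w} \<subseteq> fst H2"
      and H3: "H3 \<in> \<G>" "{w, z} \<in> snd H3" "{w, z} \<subseteq> fst H3"
      using edge[OF E(1)] edge[OF E(2)] edge[OF E(3)] by blast
    have eqs: "H2 = H1" "H3 = H1"
      using unique[OF H2(1) H1(1), of v] unique[OF H3(1) H2(1), of w] H1(3) H2(3) H3(3)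
      by simp_all
    have "path3 (snd H1) u v w z"
      using P H1(2) H2(2) H3(2) eqs by (simp add: path3_def)
    then have "strictly_cross (q H1 u) (q H1 v) (q H1 w) (q H1 z)"
      using q[OF H1(1)] by (simp add: paths_cross_def)
    moreover have "part u = H1" "part v = H1" "part w = H1" "part z = H1"
      using part[OF H1(1)] H1(3) H3(3) eqs by simp_all
    ultimately show "strictly_cross (q (part u) u) (q (part v) v) (q (part w) w) (q (part z) z)"
      by simp
  qed
  then show ?thesis by blast
qed

theorem proposition3p2:
  fixes V :: "'a set" and E :: "'a set set"
  assumes "simple_graph V E"
  shows "(\<exists>p c. local_thrackle V E p c \<and> straight_line E p c) \<longleftrightarrow>
    (\<exists>\<G>. disjoint_union \<G> V E \<and>
      (\<forall>(W, F)\<in>\<G>. caterpillar W F \<or>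
        (\<exists>k. odd k \<and> spiked_cycle W F k) \<or>
        (\<exists>k. even k \<and> 8 \<le> k \<and> spiked_cycle W F k)))"
  unfolding drawable_iff_paths_cross[OF assms]
proof
  assume "\<exists>p. paths_cross E p"
  then obtain p where p: "paths_cross E p" ..
  obtain \<G> where \<G>: "disjoint_union \<G> V E"
    and comp: "\<forall>(W, F)\<in>\<G>. simple_graph W F \<and> connected_graph W F"
    using components_exist[OF assms] .
  have "caterpillar W F \<or> (\<exists>k. odd k \<and> spiked_cycle W F k) \<or>
      (\<exists>k. even k \<and> 8 \<le> k \<and> spiked_cycle W F k)" if WF: "(W, F) \<in> \<G>" for W F
  proof -
    have "F \<subseteq> E" using \<G> WF by (auto simp: disjoint_union_def)
    then have "paths_cross F p" by (rule paths_cross_subset[OF p])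
    moreover have "simple_graph W F" "connected_graph W F"
      using comp WF by blast+
    ultimately show ?thesis
      by (intro paths_cross_component)
  qed
  then show "\<exists>\<G>. disjoint_union \<G> V E \<and>
      (\<forall>(W, F)\<in>\<G>. caterpillar W F \<or>
        (\<exists>k. odd k \<and> spiked_cycle W F k) \<or>
        (\<exists>k. even k \<and> 8 \<le> k \<and> spiked_cycle W F k))"
    using \<G> by (intro exI[of _ \<G>]) auto
next
  assume "\<exists>\<G>. disjoint_union \<G> V E \<and>
      (\<forall>(W, F)\<in>\<G>. caterpillar W F \<or>
        (\<exists>k. odd k \<and> spiked_cycle W F k) \<or>
        (\<exists>k. even k \<and> 8 \<le> k \<and> spiked_cycle W F k))"
  then obtain \<G> where \<G>: "disjoint_union \<G> V E"
    and parts: "\<forall>(W, F)\<in>\<G>. caterpillar W F \<or> (\<exists>k. odd k \<and> spiked_cycle W F k) \<or>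
        (\<exists>k. even k \<and> 8 \<le> k \<and> spiked_cycle W F k)"
    by (elim exE conjE)
  show "\<exists>p. paths_cross E p"
  proof (rule disjoint_union_paths_cross[OF \<G>])
    fix W F
    assume WF: "(W, F) \<in> \<G>"
    have G: "simple_graph W F" using \<G> WF by (auto simp: disjoint_union_def)
    show "\<exists>p. paths_cross F p"
    proof (cases "caterpillar W F")
      case True
      then show ?thesis by (rule caterpillar_paths_cross[OF G])
    next
      case False
      then obtain k where k: "spiked_cycle W F k" "odd k \<or> 8 \<le> k"
        using parts WF by blast
      obtain C where C: "cycles F = {C}" "card C = k"
        using k(1) by (auto simp: spiked_cycle_def)
      then have "C \<in> cycles F" by simp
      then obtain vs where vs: "distinct vs" "3 \<le> length vs" "C = cyc vs"
        by (auto simp: cycles_iff)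
      have "3 \<le> k"
        using card_cyc[OF vs(1,2)] vs C(2) by simp
      then have "k = 3 \<or> k = 5 \<or> 7 \<le> k"
        using k(2) by presburger
      then show ?thesis
        using spiked_drawing_exists spiked_cycle_paths_cross[OF G k(1)] by blast
    qed
  qed
qed

end
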